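(* Let $X$ be a stratified space and let $C^\infty(X)$ be a smooth structure on $X$. Then: 1. $C^\infty(X)|_S\subset C^\infty_u(S)$ for each stratum $S$ of $X$, where $C^\infty_u(S)$ is the space of all usual smooth functions on the manifold $S$. 2. $C^\infty(X)$ is partially invertible in the following sense: if $f\in C^\infty(X)$ is nowhere vanishing, then $1/f\in C^\infty(X)$.
   Context: Stratified spaces. A decomposed space is a Hausdorff paracompact finite-dimensional topological space $X$ with a locally finite collection of disjoint locally closed (smooth) manifolds $S_i\subset X$ (strata), indexed by a partially ordered set $\mathcal S$, such that $X=\bigcup_i S_i$ and $S_i\cap\bar S_j\ne\emptyset\Leftrightarrow S_i\subset\bar S_j\Leftrightarrow i\le j$. The depth of a stratum $S$ is the supremum of $n$ with strata $S=S_0<S_1<\dots<S_n$; the depth of $X$ is the supremum of the depths of its strata; $\dim X$ is the maximal dimension of the strata. For a space $L$, $cL=L\times[0,\infty)/L\times\{0\}$, $[z,t]$ is the class of $(z,t)$, and $cL(\varepsilon)=\{[z,t]\in cL: t<\varepsilon\}$. A decomposed space $X$ is a stratified space if (recursively) for each point $x$ in a stratum $S$ there are an open neighborhood $U(x)$ of $x$ in $X$, an open ball $B_x$ around $x$ in $S$, a compact stratified space $L$ (the link) and a homeomorphism $\phi_x:U(x)\to B_x\times cL(1)$ preserving the decompositions. Smooth structures. A subalgebra $C^\infty(X)$ of the algebra $C^0(X)$ of continuous real-valued functions is a $C^\infty$-ring if $G(f_1,\dots,f_n)\in C^\infty(X)$ whenever $f_i\in C^\infty(X)$, $G\in C^\infty(\mathbb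 R^n)$; it is germ-defined if every function that near each point coincides with an element of $C^\infty(X)$ belongs to $C^\infty(X)$. $SC^\infty(X)$ denotes the associated sheaf of functions. The product smooth structure on $Y_1\times Y_2$ is the germ-defined $C^\infty$-ring whose sheaf is generated by $\pi_1^*SC^\infty(Y_1)$ and $\pi_2^*SC^\infty(Y_2)$, i.e. its elements are locally of the form $G(\pi_1^*f_1,\dots,\pi_1^*f_n,\pi_2^*h_1,\dots,\pi_2^*h_k)$ with $G$ smooth, $f_i,h_j$ smooth on $Y_1,Y_2$. A smooth structure on a stratified space $X$ is (recursively on the depth) a choice of an $\mathbb R$-subalgebra $C^\infty(X)\subset C^0(X)$ such that: (1) $C^\infty(X)$ is a germ-defined $C^\infty$-ring; (2) for any $x\in X$ there is a local trivialization $\phi_x:U(x)\to B_x\times cL(1)$ with $C^\infty(U(x))=\phi_x^*(C^\infty(B_x\times cL(1)))$, where $C^\infty(B_x\times cL(1))$ is the product smooth structure of the usual smooth functions on $B_x$ and a smooth structure on $cL(1)$; (3) a smooth structure $C^\infty(cL(1))$ on the cone over a compact stratified space $L$ (with its smooth structure) must satisfy (3a) $C^\infty(cL(1))|_{L\times(0,1)}\subset C^\infty(L\times(0,1))$ (product smooth structure) and (3b) $j_*[\pi_1^*(C^\infty_{u,0}(0,1))]\subset C^\infty(cL(1))$, where $\pi_1:L\times(0,1)\to(0,1)$ is the projection, $C^\infty_{u,0}(0,1)$ is the space of usual smooth compactly supported functions and $j_*$ is extension by zero. *)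

theory Defs
  imports "HOL-Analysis.Analysis"
begin

section \<open>Smooth functions on open subsets of Euclidean n-space\<close>

text \<open>
  The dimension has to vary inside the definitions below (strata of different dimensions,
  functions of arbitrarily many variables), so the n-dimensional space is \<^const>\<open>Euclidean_space\<close>,
  whose points are the sequences vanishing from index n on.
  A function is of class C-infinity on an open set if all its iterated partial derivatives exist
  and are continuous there; \<^term>\<open>U\<close> is always open in \<^term>\<open>Euclidean_space n\<close>.
\<close>

definition partial_deriv :: "nat \<Rightarrow> ((nat \<Rightarrow> real) \<Rightarrow> real) \<Rightarrow> (nat \<Rightarrow> real) \<Rightarrow> real" where
  "partial_deriv i f u = deriv (\<lambda>t. f (u(i := t))) (u i)"

primrec Ck_on :: "nat \<Rightarrow> nat \<Rightarrow> (nat \<Rightarrow> real) set \<Rightarrow> ((nat \<Rightarrow> real) \<Rightarrow> real) \<Rightarrow> bool" where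
  "Ck_on n 0 U f \<longleftrightarrow> continuous_map (subtopology (Euclidean_space n) U) euclideanreal f"
| "Ck_on n (Suc k) U f \<longleftrightarrow>
     continuous_map (subtopology (Euclidean_space n) U) euclideanreal f \<and>
     (\<forall>i<n. (\<forall>u\<in>U. (\<lambda>t. f (u(i := t))) differentiable (at (u i))) \<and>
            Ck_on n k U (partial_deriv i f))"

definition smooth_on :: "nat \<Rightarrow> (nat \<Rightarrow> real) set \<Rightarrow> ((nat \<Rightarrow> real) \<Rightarrow> real) \<Rightarrow> bool" where
  "smooth_on n U f \<longleftrightarrow> (\<forall>k. Ck_on n k U f)"

definition smooth_map_on ::
    "nat \<Rightarrow> (nat \<Rightarrow> real) set \<Rightarrow> nat \<Rightarrow> ((nat \<Rightarrow> real) \<Rightarrow> (nat \<Rightarrow> real)) \<Rightarrow> bool" where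
  "smooth_map_on n U m F \<longleftrightarrow> (\<forall>j<m. smooth_on n U (\<lambda>u. F u j))"


section \<open>Smooth manifolds\<close>

text \<open>A chart is a pair of its domain and the coordinate map. Atlases need not be maximal.\<close>

record 'a mfd =
  mfd_top :: "'a topology"
  mfd_dim :: nat
  mfd_charts :: "('a set \<times> ('a \<Rightarrow> nat \<Rightarrow> real)) set"

abbreviation mfd_points :: "'a mfd \<Rightarrow> 'a set" where
  "mfd_points M \<equiv> topspace (mfd_top M)"

definition smooth_manifold :: "'a mfd \<Rightarrow> bool" where
  "smooth_manifold M \<longleftrightarrow>
     Hausdorff_space (mfd_top M) \<and> second_countable (mfd_top M) \<and>
     (\<Union>(D, \<psi>) \<in> mfd_charts M. D) = mfd_points M \<and>
     (\<forall>(D, \<psi>) \<in> mfd_charts M.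
        openin (mfd_top M) D \<and>
        (\<exists>V. openin (Euclidean_space (mfd_dim M)) V \<and>
             homeomorphic_map (subtopology (mfd_top M) D)
               (subtopology (Euclidean_space (mfd_dim M)) V) \<psi>)) \<and>
     (\<forall>(D, \<psi>) \<in> mfd_charts M. \<forall>(E, \<eta>) \<in> mfd_charts M.
        smooth_map_on (mfd_dim M) (\<psi> ` (D \<inter> E)) (mfd_dim M) (\<eta> \<circ> inv_into D \<psi>))"

definition smooth_funs :: "'a mfd \<Rightarrow> ('a \<Rightarrow> real) set" where
  "smooth_funs M =
     {f. \<forall>(D, \<psi>) \<in> mfd_charts M. smooth_on (mfd_dim M) (\<psi> ` D) (f \<circ> inv_into D \<psi>)}"

definition mfd_smooth_map :: "'a mfd \<Rightarrow> 'b mfd \<Rightarrow> ('a \<Rightarrow> 'b) \<Rightarrow> bool" where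
  "mfd_smooth_map M N h \<longleftrightarrow>
     continuous_map (mfd_top M) (mfd_top N) h \<and>
     (\<forall>(D, \<psi>) \<in> mfd_charts M. \<forall>(E, \<eta>) \<in> mfd_charts N.
        smooth_map_on (mfd_dim M) (\<psi> ` {p \<in> D. h p \<in> E}) (mfd_dim N)
          (\<eta> \<circ> h \<circ> inv_into D \<psi>))"

definition mfd_diffeo :: "'a mfd \<Rightarrow> 'b mfd \<Rightarrow> ('a \<Rightarrow> 'b) \<Rightarrow> bool" where
  "mfd_diffeo M N h \<longleftrightarrow>
     (\<exists>k. homeomorphic_maps (mfd_top M) (mfd_top N) h k \<and>
          mfd_smooth_map M N h \<and> mfd_smooth_map N M k)"

definition open_submfd :: "'a mfd \<Rightarrow> 'a set \<Rightarrow> 'a mfd" where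
  "open_submfd M B =
     \<lparr>mfd_top = subtopology (mfd_top M) B, mfd_dim = mfd_dim M,
      mfd_charts = (\<lambda>(D, \<psi>). (D \<inter> B, \<psi>)) ` mfd_charts M\<rparr>"

definition prod_mfd :: "'a mfd \<Rightarrow> 'b mfd \<Rightarrow> ('a \<times> 'b) mfd" where
  "prod_mfd M N =
     \<lparr>mfd_top = prod_topology (mfd_top M) (mfd_top N), mfd_dim = mfd_dim M + mfd_dim N,
      mfd_charts =
        {(D \<times> E, \<lambda>(p, q) i. if i < mfd_dim M then \<psi> p i else \<eta> q (i - mfd_dim M)) | D \<psi> E \<eta>.
           (D, \<psi>) \<in> mfd_charts M \<and> (E, \<eta>) \<in> mfd_charts N}\<rparr>"

definition ball_mfd :: "nat \<Rightarrow> (nat \<Rightarrow> real) mfd" where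
  "ball_mfd n =
     (let B = {u \<in> topspace (Euclidean_space n). (\<Sum>i<n. (u i)\<^sup>2) < 1}
      in \<lparr>mfd_top = subtopology (Euclidean_space n) B, mfd_dim = n, mfd_charts = {(B, id)}\<rparr>)"

definition unit_interval_mfd :: "real mfd" where
  "unit_interval_mfd =
     \<lparr>mfd_top = top_of_set {0<..<1}, mfd_dim = 1,
      mfd_charts = {({0<..<1}, \<lambda>t i. if i = 0 then t else 0)}\<rparr>"

definition open_ball_around :: "'a mfd \<Rightarrow> 'a \<Rightarrow> 'a set \<Rightarrow> bool" where
  "open_ball_around M x B \<longleftrightarrow>
     openin (mfd_top M) B \<and> x \<in> B \<and>
     (\<exists>\<beta>. mfd_diffeo (open_submfd M B) (ball_mfd (mfd_dim M)) \<beta> \<and> \<beta> x = (\<lambda>_. 0))"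


section \<open>Decomposed spaces\<close>

record ('a, 'i) decomp =
  dec_top :: "'a topology"
  dec_index :: "'i set"
  dec_order :: "'i rel"
  dec_stratum :: "'i \<Rightarrow> 'a mfd"

abbreviation stratum_set :: "('a, 'i) decomp \<Rightarrow> 'i \<Rightarrow> 'a set" where
  "stratum_set X i \<equiv> mfd_points (dec_stratum X i)"

definition paracompact_space :: "'a topology \<Rightarrow> bool" where
  "paracompact_space T \<longleftrightarrow>
     (\<forall>\<U>. (\<forall>U\<in>\<U>. openin T U) \<and> \<Union>\<U> = topspace T \<longrightarrow>
        (\<exists>\<V>. (\<forall>V\<in>\<V>. openin T V \<and> (\<exists>U\<in>\<U>. V \<subseteq> U)) \<and> \<Union>\<V> = topspace T \<and>
              locally_finite_in T \<V>))"

text \<open>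
  Finite-dimensionality refers to the small inductive dimension \<open>dim_le\<close>; on separable metrizable
  spaces it coincides with the covering dimension.
  The last condition (the frontier condition) forces the strata to be non-empty.
\<close>

definition decomposed_space :: "('a, 'i) decomp \<Rightarrow> bool" where
  "decomposed_space X \<longleftrightarrow>
     Hausdorff_space (dec_top X) \<and> paracompact_space (dec_top X) \<and> (\<exists>n. dec_top X dim_le n) \<and>
     partial_order_on (dec_index X) (dec_order X) \<and>
     (\<forall>i\<in>dec_index X.
        smooth_manifold (dec_stratum X i) \<and>
        mfd_top (dec_stratum X i) = subtopology (dec_top X) (stratum_set X i) \<and>
        (\<exists>U F. openin (dec_top X) U \<and> closedin (dec_top X) F \<and> stratum_set X i = U \<inter> F)) \<and>
     disjoint_family_on (stratum_set X) (dec_index X) \<and>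
     (\<Union>i\<in>dec_index X. stratum_set X i) = topspace (dec_top X) \<and>
     (\<forall>x\<in>topspace (dec_top X). \<exists>U. openin (dec_top X) U \<and> x \<in> U \<and>
        finite {i \<in> dec_index X. stratum_set X i \<inter> U \<noteq> {}}) \<and>
     (\<forall>i\<in>dec_index X. \<forall>j\<in>dec_index X.
        (stratum_set X i \<inter> (dec_top X closure_of stratum_set X j) \<noteq> {} \<longleftrightarrow>
           stratum_set X i \<subseteq> dec_top X closure_of stratum_set X j) \<and>
        (stratum_set X i \<subseteq> dec_top X closure_of stratum_set X j \<longleftrightarrow> (i, j) \<in> dec_order X))"

definition restrict_decomp :: "('a, 'i) decomp \<Rightarrow> 'a set \<Rightarrow> ('a, 'i) decomp" where
  "restrict_decomp X U =
     (let I = {i \<in> dec_index X. stratum_set X i \<inter> U \<noteq> {}}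
      in \<lparr>dec_top = subtopology (dec_top X) U, dec_index = I, dec_order = dec_order X \<inter> I \<times> I,
          dec_stratum = (\<lambda>i. open_submfd (dec_stratum X i) (stratum_set X i \<inter> U))\<rparr>)"

definition prod_decomp :: "'a mfd \<Rightarrow> ('b, 'i) decomp \<Rightarrow> ('a \<times> 'b, 'i) decomp" where
  "prod_decomp M Y =
     \<lparr>dec_top = prod_topology (mfd_top M) (dec_top Y), dec_index = dec_index Y,
      dec_order = dec_order Y, dec_stratum = (\<lambda>i. prod_mfd M (dec_stratum Y i))\<rparr>"

text \<open>
  A decomposition consists of smooth manifolds, so a homeomorphism preserving the decompositions
  maps strata onto strata diffeomorphically. (If its restrictions to strata were only
  homeomorphisms, a smooth structure could induce an arbitrary smooth atlas on a stratum.)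
  As the strata partition both spaces, each stratum of \<^term>\<open>Y\<close> is then the image of one of
  \<^term>\<open>X\<close>, and the partial orders, being determined by closures, correspond.
\<close>

definition decomp_iso :: "('a, 'i) decomp \<Rightarrow> ('b, 'j) decomp \<Rightarrow> ('a \<Rightarrow> 'b) \<Rightarrow> bool" where
  "decomp_iso X Y \<phi> \<longleftrightarrow>
     homeomorphic_map (dec_top X) (dec_top Y) \<phi> \<and>
     (\<forall>i\<in>dec_index X. \<exists>j\<in>dec_index Y. mfd_diffeo (dec_stratum X i) (dec_stratum Y j) \<phi>)"


section \<open>Cones\<close>

text \<open>
  The points of the cone are the classes: singletons for positive height, and the apex
  L x {0}. For empty L the apex is the empty set, i.e. the cone over the empty space is a point.
\<close>

definition cone_apex :: "'a topology \<Rightarrow> ('a \<times> real) set" where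
  "cone_apex T = topspace T \<times> {0}"

definition cone_class :: "'a topology \<Rightarrow> 'a \<Rightarrow> real \<Rightarrow> ('a \<times> real) set" where
  "cone_class T z t = (if t = 0 then cone_apex T else {(z, t)})"

definition cone_points :: "'a topology \<Rightarrow> ('a \<times> real) set set" where
  "cone_points T = insert (cone_apex T) {cone_class T z t | z t. z \<in> topspace T \<and> 0 \<le> t}"

definition cone_open :: "'a topology \<Rightarrow> ('a \<times> real) set set \<Rightarrow> bool" where
  "cone_open T W \<longleftrightarrow>
     W \<subseteq> cone_points T \<and>
     openin (prod_topology T (top_of_set {0..}))
       {(z, t). z \<in> topspace T \<and> 0 \<le> t \<and> cone_class T z t \<in> W}"

definition cone_top :: "'a topology \<Rightarrow> ('a \<times> real) set topology" where
  "cone_top T = topology (cone_open T)"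

lemma istopology_cone_open: "istopology (cone_open T)"
  unfolding istopology_def
proof (intro conjI allI impI)
  fix S W
  assume S: "cone_open T S" and W: "cone_open T W"
  have eq: "{(z, t). z \<in> topspace T \<and> 0 \<le> t \<and> cone_class T z t \<in> S \<inter> W} =
        {(z, t). z \<in> topspace T \<and> 0 \<le> t \<and> cone_class T z t \<in> S} \<inter>
        {(z, t). z \<in> topspace T \<and> 0 \<le> t \<and> cone_class T z t \<in> W}"
    by auto
  show "cone_open T (S \<inter> W)"
    using S W unfolding cone_open_def eq by blast
next
  fix \<K>
  assume K: "\<forall>K\<in>\<K>. cone_open T K"
  have eq: "{(z, t). z \<in> topspace T \<and> 0 \<le> t \<and> cone_class T z t \<in> \<Union>\<K>} =
        (\<Union>K\<in>\<K>. {(z, t). z \<in> topspace T \<and> 0 \<le> t \<and> cone_class T z t \<in> K})"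
    by auto
  show "cone_open T (\<Union>\<K>)"
    using K unfolding cone_open_def eq by (auto intro!: openin_Union)
qed

lemma openin_cone_top: "openin (cone_top T) W \<longleftrightarrow> cone_open T W"
  unfolding cone_top_def by (simp add: istopology_cone_open topology_inverse')

definition open_cone_top :: "'a topology \<Rightarrow> real \<Rightarrow> ('a \<times> real) set topology" where
  "open_cone_top T \<epsilon> =
     subtopology (cone_top T)
       (insert (cone_apex T) {cone_class T z t | z t. z \<in> topspace T \<and> 0 \<le> t \<and> t < \<epsilon>})"

text \<open>
  The decomposed space cL(1): its strata are the apex (index \<^const>\<open>None\<close>), a manifold of
  dimension 0, and the image of \<open>L\<^sub>j \<times> (0,1)\<close> (index \<^term>\<open>Some j\<close>) for each stratum of L.
\<close>

definition cone_stratum :: "('a, 'i) decomp \<Rightarrow> 'i option \<Rightarrow> ('a \<times> real) set mfd" where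
  "cone_stratum L k =
     (case k of
        None \<Rightarrow>
          \<lparr>mfd_top = subtopology (open_cone_top (dec_top L) 1) {cone_apex (dec_top L)},
           mfd_dim = 0, mfd_charts = {({cone_apex (dec_top L)}, \<lambda>_ _. 0)}\<rparr>
      | Some j \<Rightarrow>
          (let M = prod_mfd (dec_stratum L j) unit_interval_mfd;
               h = (\<lambda>(z, t). cone_class (dec_top L) z t)
           in \<lparr>mfd_top = subtopology (open_cone_top (dec_top L) 1) (h ` mfd_points M),
               mfd_dim = mfd_dim M,
               mfd_charts = (\<lambda>(D, \<psi>). (h ` D, \<psi> \<circ> inv_into D h)) ` mfd_charts M\<rparr>))"

definition cone_decomp :: "('a, 'i) decomp \<Rightarrow> (('a \<times> real) set, 'i option) decomp" where
  "cone_decomp L =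
     \<lparr>dec_top = open_cone_top (dec_top L) 1,
      dec_index = insert None (Some ` dec_index L),
      dec_order = {(None, k) | k. k \<in> insert None (Some ` dec_index L)} \<union>
                  {(Some i, Some j) | i j. (i, j) \<in> dec_order L},
      dec_stratum = cone_stratum L\<rparr>"


section \<open>Stratified spaces\<close>

text \<open>
  \<open>local_triv X i x U B L \<phi>\<close>: the map \<open>\<phi>\<close> is a decomposition preserving homeomorphism from the
  neighbourhood \<open>U\<close> of \<open>x\<close> onto \<open>B \<times> cL(1)\<close>, where \<open>B\<close> is a ball around \<open>x\<close> in the stratum \<open>i\<close>.
  The link L has points and indices of the same types as X. This is no restriction:
  L embeds into X as \<open>{b} \<times> L \<times> {1/2}\<close>, and distinct strata of L lie in distinct strata of X.
\<close>

definition local_triv ::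
    "('a, 'i) decomp \<Rightarrow> 'i \<Rightarrow> 'a \<Rightarrow> 'a set \<Rightarrow> 'a set \<Rightarrow> ('a, 'i) decomp \<Rightarrow>
     ('a \<Rightarrow> 'a \<times> ('a \<times> real) set) \<Rightarrow> bool" where
  "local_triv X i x U B L \<phi> \<longleftrightarrow>
     openin (dec_top X) U \<and> x \<in> U \<and> open_ball_around (dec_stratum X i) x B \<and>
     compact_space (dec_top L) \<and>
     decomp_iso (restrict_decomp X U)
       (prod_decomp (open_submfd (dec_stratum X i) B) (cone_decomp L)) \<phi>"

text \<open>The recursion is started by the empty space, the link of a point in a stratum of depth 0.\<close>

inductive stratified_space :: "('a, 'i) decomp \<Rightarrow> bool" where
  "\<lbrakk>decomposed_space X;
    \<forall>i\<in>dec_index X. \<forall>x\<in>stratum_set X i.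
      \<exists>U B L \<phi>. stratified_space L \<and> local_triv X i x U B L \<phi>\<rbrakk>
   \<Longrightarrow> stratified_space X"


section \<open>Smooth structures\<close>

text \<open>
  A real function on a space T is represented by any total function with the right values on
  \<^term>\<open>topspace T\<close>; all sets of functions below are closed under changing values elsewhere.
\<close>

definition continuous_subalgebra :: "'a topology \<Rightarrow> ('a \<Rightarrow> real) set \<Rightarrow> bool" where
  "continuous_subalgebra T C \<longleftrightarrow>
     (\<forall>f\<in>C. continuous_map T euclideanreal f) \<and>
     (\<forall>c. (\<lambda>_. c) \<in> C) \<and>
     (\<forall>f\<in>C. \<forall>g\<in>C. (\<lambda>x. f x + g x) \<in> C \<and> (\<lambda>x. f x * g x) \<in> C)"

definition Cinf_ring :: "('a \<Rightarrow> real) set \<Rightarrow> bool" where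
  "Cinf_ring C \<longleftrightarrow>
     (\<forall>n G fs. smooth_on n (topspace (Euclidean_space n)) G \<and> (\<forall>i<n. fs i \<in> C) \<longrightarrow>
        (\<lambda>x. G (\<lambda>i. if i < n then fs i x else 0)) \<in> C)"

definition sheaf_sections :: "'a topology \<Rightarrow> ('a \<Rightarrow> real) set \<Rightarrow> 'a set \<Rightarrow> ('a \<Rightarrow> real) set" where
  "sheaf_sections T C U =
     {f. \<forall>p\<in>U. \<exists>V g. openin T V \<and> p \<in> V \<and> V \<subseteq> U \<and> g \<in> C \<and> (\<forall>q\<in>V. f q = g q)}"

definition germ_defined :: "'a topology \<Rightarrow> ('a \<Rightarrow> real) set \<Rightarrow> bool" where
  "germ_defined T C \<longleftrightarrow> sheaf_sections T C (topspace T) \<subseteq> C"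

definition prod_smooth ::
    "'a topology \<Rightarrow> ('a \<Rightarrow> real) set \<Rightarrow> 'b topology \<Rightarrow> ('b \<Rightarrow> real) set \<Rightarrow> ('a \<times> 'b \<Rightarrow> real) set" where
  "prod_smooth T1 C1 T2 C2 =
     {f. \<forall>p\<in>topspace (prod_topology T1 T2).
        \<exists>V n k G fs hs. openin (prod_topology T1 T2) V \<and> p \<in> V \<and>
          smooth_on (n + k) (topspace (Euclidean_space (n + k))) G \<and>
          (\<forall>i<n. fs i \<in> C1) \<and> (\<forall>j<k. hs j \<in> C2) \<and>
          (\<forall>(a, b)\<in>V. f (a, b) =
             G (\<lambda>i. if i < n then fs i a else if i < n + k then hs (i - n) b else 0))}"

text \<open>
  Smooth structures on the cone cL(1) over a compact space L with smooth structure CL, where the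
  set \<open>L \<times> (0,1)\<close> is identified with its image under \<^const>\<open>cone_class\<close>. Local triviality at
  the apex would refer to cL(1) itself and is not part of this notion.
\<close>

definition cone_smooth_structure ::
    "('a, 'i) decomp \<Rightarrow> ('a \<Rightarrow> real) set \<Rightarrow> (('a \<times> real) set \<Rightarrow> real) set \<Rightarrow> bool" where
  "cone_smooth_structure L CL A \<longleftrightarrow>
     continuous_subalgebra (open_cone_top (dec_top L) 1) A \<and>
     Cinf_ring A \<and> germ_defined (open_cone_top (dec_top L) 1) A \<and>
     (\<forall>g\<in>A. (\<lambda>(z, t). g (cone_class (dec_top L) z t))
        \<in> prod_smooth (dec_top L) CL (mfd_top unit_interval_mfd) (smooth_funs unit_interval_mfd)) \<and>
     (\<forall>\<rho>\<in>smooth_funs unit_interval_mfd.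
        (\<exists>K. compact K \<and> K \<subseteq> {0<..<1} \<and> (\<forall>t\<in>{0<..<1} - K. \<rho> t = 0)) \<longrightarrow>
        (\<forall>g. g (cone_apex (dec_top L)) = 0 \<and>
             (\<forall>z\<in>topspace (dec_top L). \<forall>t\<in>{0<..<1}. g (cone_class (dec_top L) z t) = \<rho> t)
             \<longrightarrow> g \<in> A))"

inductive smooth_structure :: "('a, 'i) decomp \<Rightarrow> ('a \<Rightarrow> real) set \<Rightarrow> bool" where
  "\<lbrakk>continuous_subalgebra (dec_top X) C; Cinf_ring C; germ_defined (dec_top X) C;
    \<forall>i\<in>dec_index X. \<forall>x\<in>stratum_set X i.
      \<exists>U B L \<phi> CL A.
        stratified_space L \<and> local_triv X i x U B L \<phi> \<and>
        smooth_structure L CL \<and> cone_smooth_structure L CL A \<and>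
        sheaf_sections (dec_top X) C U =
          {f. \<exists>g \<in> prod_smooth
                     (mfd_top (open_submfd (dec_stratum X i) B))
                     (smooth_funs (open_submfd (dec_stratum X i) B))
                     (open_cone_top (dec_top L) 1) A.
                \<forall>p\<in>U. f p = g (\<phi> p)}\<rbrakk>
   \<Longrightarrow> smooth_structure X C"

end

theory Submission
  imports Defs
begin

text \<open>
  The restriction to strata is proved by induction on the smooth structure. In a local trivialization
  \<open>U \<rightarrow> B \<times> cL(1)\<close> a smooth function is locally \<open>G\<close> applied to smooth functions on \<open>B\<close> and on the cone.
  On the apex the latter are constant, and on \<open>L\<^sub>j \<times> (0,1)\<close> condition (3a) expresses them locally by
  smooth functions on \<open>(0,1)\<close> and elements of the smooth structure of \<open>L\<close>, which are smooth on \<open>L\<^sub>j\<close>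
  by induction. As the trivialization is a diffeomorphism on strata, the chain rule finishes the argument.

  For reciprocals, near a point with \<open>f \<noteq> 0\<close> the function \<open>1 / f\<close> coincides with \<open>f \<cdot> G(f)\<close>, where \<open>G\<close> is
  smooth on the whole line and equal to \<open>1 / s\<^sup>2\<close> away from 0; germ-definedness glues these.
\<close>

section \<open>Calculus for iterated partial derivatives\<close>

text \<open>Smoothness is given through iterated partial derivatives of functions on sequences,
  without a total derivative, so the chain rule has to be extracted from the continuity of the
  partial derivatives. Smooth functions are tested chart by chart through \<open>inv_into\<close>,
  and the charts on the cone strata are transported through the quotient map. For all manifolds
  involved only open coordinate images and continuous inverse charts are carried along; functions
  are then compared in the very charts from which the new ones are built. For reciprocals the
  difficulty is that the C-infinity ring axiom admits only functions \<open>G\<close> smooth on the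
  whole of Euclidean space, while \<open>1 / s\<close> is singular at 0 and \<open>f\<close> may
  come arbitrarily close to 0. Writing \<open>1 / f\<close> as \<open>f / f\<^sup>2\<close> leaves
  only a positive quantity to invert, whatever the sign of \<open>f\<close>. The correction to the
  denominator must be positive at 0 and yet vanish on an open set, which is why a smooth but
  non-analytic function is needed.\<close>

lemma openin_Euclidean_space_iff:
  "openin (Euclidean_space n) U \<longleftrightarrow> (\<exists>T. open T \<and> U = T \<inter> topspace (Euclidean_space n))"
  unfolding Euclidean_space_def euclidean_product_topology openin_subtopology topspace_subtopology
  by auto

text \<open>\<open>Euclidean_space n\<close> is a subspace of the product topology on
  \<open>nat \<Rightarrow> real\<close>, so continuity becomes \<open>continuous_on\<close> and the
  analysis library applies.\<close>

lemma continuous_map_Euclidean_subspace_iff: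
  "continuous_map (subtopology (Euclidean_space n) U) (euclidean :: 'b::topological_space topology) f \<longleftrightarrow>
   continuous_on (U \<inter> topspace (Euclidean_space n)) f"
  unfolding Euclidean_space_def euclidean_product_topology subtopology_subtopology
    continuous_map_iff_continuous topspace_subtopology
  by (simp add: Int_commute)

lemma Euclidean_space_fun_upd:
  assumes "u \<in> topspace (Euclidean_space n)" "i < n"
  shows "u(i := t) \<in> topspace (Euclidean_space n)"
  using assms by (auto simp: topspace_Euclidean_space)

text \<open>The filter is \<open>nhds\<close> and not \<open>at\<close>, since exchanging functions
  under a derivative also needs agreement at the base point. As \<open>i < n\<close>, the coordinate
  line does not leave \<open>Euclidean_space n\<close>.\<close>

lemma eventually_fun_upd_in_open:
  assumes U: "openin (Euclidean_space n) U" and u: "u \<in> U" and i: "i < n"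
  shows "\<forall>\<^sub>F t in nhds (u i). u(i := t) \<in> U"
proof -
  obtain T where T: "open T" "U = T \<inter> topspace (Euclidean_space n)"
    using U openin_Euclidean_space_iff by blast
  have "continuous_on UNIV (\<lambda>t. u(i := t))"
  proof (rule continuous_on_coordinatewise_then_product)
    show "continuous_on UNIV (\<lambda>t. (u(i := t)) j)" for j
      by (cases "j = i") auto
  qed
  then have "open ((\<lambda>t. u(i := t)) -` T)"
    using T(1) by (simp add: continuous_on_open_vimage)
  moreover have "u i \<in> (\<lambda>t. u(i := t)) -` T"
    using u T by simp
  ultimately show ?thesis
    using T i u Euclidean_space_fun_upd by (auto simp: eventually_nhds)
qed

text \<open>Openness puts a whole interval of the coordinate line through \<open>u\<close> into
  \<open>U\<close>, and the derivative sees nothing else.\<close>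

lemma partial_deriv_cong:
  assumes U: "openin (Euclidean_space n) U" and eq: "\<And>v. v \<in> U \<Longrightarrow> f v = g v"
    and u: "u \<in> U" and i: "i < n"
  shows "partial_deriv i f u = partial_deriv i g u"
    and "(\<lambda>t. f (u(i := t))) differentiable (at (u i)) \<longleftrightarrow>
         (\<lambda>t. g (u(i := t))) differentiable (at (u i))"
proof -
  have ev: "\<forall>\<^sub>F t in nhds (u i). f (u(i := t)) = g (u(i := t))"
    using eventually_fun_upd_in_open[OF U u i] by eventually_elim (rule eq)
  show "partial_deriv i f u = partial_deriv i g u"
    unfolding partial_deriv_def by (rule deriv_cong_ev[OF ev refl])
  show "(\<lambda>t. f (u(i := t))) differentiable (at (u i)) \<longleftrightarrow>
         (\<lambda>t. g (u(i := t))) differentiable (at (u i))"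
    unfolding real_differentiable_def using DERIV_cong_ev[OF refl ev refl] by blast
qed

section \<open>The classes C^k: order, locality and algebra\<close>

lemma Ck_on_continuous:
  assumes "Ck_on n k U f" "U \<subseteq> topspace (Euclidean_space n)"
  shows "continuous_on U f"
  using assms by (cases k) (simp_all add: continuous_map_Euclidean_subspace_iff Int_absorb2)


text \<open>By definition, order \<open>Suc k\<close> mentions order \<open>k\<close> only for the
  partial derivatives, so the drop of order for \<open>f\<close> itself goes by induction through
  them.\<close>

lemma Ck_on_SucD: "Ck_on n (Suc k) U f \<Longrightarrow> Ck_on n k U f"
proof (induction k arbitrary: f)
  case 0
  then show ?case by simp
next
  case (Suc k)
  have "Ck_on n k U (partial_deriv i f)" if "i < n" for i
    by (rule Suc.IH) (use Suc.prems that in simp)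
  then show ?case
    using Suc.prems by simp
qed

lemma continuous_on_Euclidean_local:
  assumes U: "openin (Euclidean_space n) U"
    and loc: "\<And>u. u \<in> U \<Longrightarrow> \<exists>V g. openin (Euclidean_space n) V \<and> u \<in> V \<and> continuous_on V g \<and> (\<forall>v\<in>V. f v = g v)"
  shows "continuous_on U f"
  unfolding continuous_on_topological
proof (intro ballI allI impI)
  fix u B assume u: "u \<in> U" and B: "open B" "f u \<in> B"
  obtain V g where V: "openin (Euclidean_space n) V" "u \<in> V" "continuous_on V g" "\<forall>v\<in>V. f v = g v"
    using loc u by blast
  then obtain A where A: "open A" "u \<in> A" "\<forall>v\<in>V. v \<in> A \<longrightarrow> g v \<in> B"
    unfolding continuous_on_topological using B by metis
  obtain T where T: "open T" "V = T \<inter> topspace (Euclidean_space n)"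
    using V openin_Euclidean_space_iff by blast
  show "\<exists>A. open A \<and> u \<in> A \<and> (\<forall>y\<in>U. y \<in> A \<longrightarrow> f y \<in> B)"
    using A T V openin_subset[OF U] by (intro exI[of _ "A \<inter> T"]) auto
qed

text \<open>Stated with an open cover, so that congruence is the special case of a one-element cover.\<close>

lemma Ck_on_local:
  assumes U: "openin (Euclidean_space n) U"
    and "\<And>u. u \<in> U \<Longrightarrow> \<exists>V g. openin (Euclidean_space n) V \<and> u \<in> V \<and> Ck_on n k V g \<and> (\<forall>v\<in>V. f v = g v)"
  shows "Ck_on n k U f"
  using assms(2)
proof (induction k arbitrary: f)
  case 0
  have "continuous_on U f"
    by (rule continuous_on_Euclidean_local[OF U]) (meson 0 Ck_on_continuous openin_subset)
  then show ?case
    by (simp add: continuous_map_Euclidean_subspace_iff openin_subset[OF U] Int_absorb2)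
next
  case (Suc k)
  have "continuous_on U f"
    by (rule continuous_on_Euclidean_local[OF U]) (meson Suc.prems Ck_on_continuous openin_subset)
  then have "continuous_map (subtopology (Euclidean_space n) U) euclideanreal f"
    by (simp add: continuous_map_Euclidean_subspace_iff openin_subset[OF U] Int_absorb2)
  moreover have "(\<lambda>t. f (u(i := t))) differentiable (at (u i))" if i: "i < n" and u: "u \<in> U" for i u
  proof -
    obtain V g where V: "openin (Euclidean_space n) V" "u \<in> V" "Ck_on n (Suc k) V g" "\<forall>v\<in>V. f v = g v"
      using Suc.prems u by blast
    then show ?thesis
      using partial_deriv_cong(2)[of n V f g u i] i by auto
  qed
  moreover have "Ck_on n k U (partial_deriv i f)" if i: "i < n" for i
  proof (rule Suc.IH)
    fix u assume u: "u \<in> U"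
    obtain V g where V: "openin (Euclidean_space n) V" "u \<in> V" "Ck_on n (Suc k) V g" "\<forall>v\<in>V. f v = g v"
      using Suc.prems u by blast
    then have "\<forall>v\<in>V. partial_deriv i f v = partial_deriv i g v" "Ck_on n k V (partial_deriv i g)"
      using partial_deriv_cong(1)[of n V f g _ i] i by auto
    then show "\<exists>V g. openin (Euclidean_space n) V \<and> u \<in> V \<and> Ck_on n k V g \<and>
        (\<forall>v\<in>V. partial_deriv i f v = g v)"
      using V by blast
  qed
  ultimately show ?case
    by simp
qed

lemma Ck_on_cong:
  assumes "openin (Euclidean_space n) U" "Ck_on n k U g" "\<And>u. u \<in> U \<Longrightarrow> f u = g u"
  shows "Ck_on n k U f"
  by (rule Ck_on_local[OF assms(1)]) (use assms in blast)

text \<open>Allows derivatives to be supplied by a formula. Off \<open>U\<close> the formula may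
  differ from \<open>partial_deriv i f\<close>, so its smoothness is transferred by
  \<open>Ck_on_cong\<close>.\<close>

lemma Ck_on_SucI:
  assumes U: "openin (Euclidean_space n) U" and f: "continuous_on U f"
    and der: "\<And>i u. i < n \<Longrightarrow> u \<in> U \<Longrightarrow> ((\<lambda>t. f (u(i := t))) has_real_derivative f' i u) (at (u i))"
    and f': "\<And>i. i < n \<Longrightarrow> Ck_on n k U (f' i)"
  shows "Ck_on n (Suc k) U f"
proof -
  have "Ck_on n k U (partial_deriv i f)" if "i < n" for i
    by (rule Ck_on_cong[OF U f'[OF that]]) (simp add: partial_deriv_def DERIV_imp_deriv der that)
  then show ?thesis
    using f der by (auto simp: continuous_map_Euclidean_subspace_iff openin_subset[OF U] Int_absorb2
        real_differentiable_def)
qed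

lemma Ck_on_DERIV:
  assumes "Ck_on n (Suc k) U f" "i < n" "u \<in> U"
  shows "((\<lambda>t. f (u(i := t))) has_real_derivative partial_deriv i f u) (at (u i))"
  using assms unfolding partial_deriv_def
  by (auto simp: DERIV_deriv_iff_real_differentiable)

lemma Ck_on_0: "U \<subseteq> topspace (Euclidean_space n) \<Longrightarrow> Ck_on n 0 U f \<longleftrightarrow> continuous_on U f"
  by (simp add: continuous_map_Euclidean_subspace_iff Int_absorb2)

lemma Ck_on_const:
  assumes "openin (Euclidean_space n) U"
  shows "Ck_on n k U (\<lambda>_. c)"
proof (induction k arbitrary: c)
  case 0
  then show ?case
    using assms by (simp add: Ck_on_0 openin_subset)
next
  case (Suc k)
  show ?case
    by (rule Ck_on_SucI[OF assms, where f' = "\<lambda>_ _. 0"]) (auto intro: Suc)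
qed

lemma Ck_on_coordinate:
  assumes U: "openin (Euclidean_space n) U"
  shows "Ck_on n k U (\<lambda>u. u j)"
proof (cases k)
  case 0
  then show ?thesis
    using U continuous_on_subset[OF continuous_on_product_coordinates subset_UNIV]
    by (metis Ck_on_0 openin_subset)
next
  case (Suc l)
  show ?thesis
    unfolding Suc
  proof (rule Ck_on_SucI[OF U, where f' = "\<lambda>i _. if i = j then 1 else 0"])
    show "continuous_on U (\<lambda>u. u j)"
      by (rule continuous_on_subset[OF continuous_on_product_coordinates subset_UNIV])
    show "((\<lambda>t. (u(i := t)) j) has_real_derivative (if i = j then 1 else 0)) (at (u i))" for i u
      by (cases "i = j") auto
  qed (rule Ck_on_const[OF U])
qed

lemma Ck_on_add:
  assumes U: "openin (Euclidean_space n) U"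
  shows "Ck_on n k U f \<Longrightarrow> Ck_on n k U g \<Longrightarrow> Ck_on n k U (\<lambda>u. f u + g u)"
proof (induction k arbitrary: f g)
  case 0
  then show ?case
    using U by (simp add: Ck_on_0 openin_subset continuous_on_add del: Ck_on.simps)
next
  case (Suc k)
  show ?case
  proof (rule Ck_on_SucI[OF U, where f' = "\<lambda>i u. partial_deriv i f u + partial_deriv i g u"])
    show "continuous_on U (\<lambda>u. f u + g u)"
      using Suc.prems by (intro continuous_on_add Ck_on_continuous[OF _ openin_subset[OF U]])
    show "Ck_on n k U (\<lambda>u. partial_deriv i f u + partial_deriv i g u)" if "i < n" for i
      using Suc.prems that by (intro Suc.IH) simp_all
  qed (intro derivative_intros Ck_on_DERIV[OF Suc.prems(1)] Ck_on_DERIV[OF Suc.prems(2)])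
qed

lemma Ck_on_mult:
  assumes U: "openin (Euclidean_space n) U"
  shows "Ck_on n k U f \<Longrightarrow> Ck_on n k U g \<Longrightarrow> Ck_on n k U (\<lambda>u. f u * g u)"
proof (induction k arbitrary: f g)
  case 0
  then show ?case
    using U by (simp add: Ck_on_0 openin_subset continuous_on_mult del: Ck_on.simps)
next
  case (Suc k)
  show ?case
  proof (rule Ck_on_SucI[OF U, where f' = "\<lambda>i u. partial_deriv i f u * g u + partial_deriv i g u * f u"])
    show "continuous_on U (\<lambda>u. f u * g u)"
      using Suc.prems by (intro continuous_on_mult Ck_on_continuous[OF _ openin_subset[OF U]])
    \<comment> \<open>The Leibniz formula contains the undifferentiated factors, which are therefore
      needed at order \<open>k\<close> as well.\<close>
    show "Ck_on n k U (\<lambda>u. partial_deriv i f u * g u + partial_deriv i g u * f u)" if "i < n" for i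
      using Suc.prems that Ck_on_SucD[OF Suc.prems(1)] Ck_on_SucD[OF Suc.prems(2)]
      by (intro Suc.IH Ck_on_add[OF U]) simp_all
    show "((\<lambda>t. f (u(i := t)) * g (u(i := t))) has_real_derivative
        partial_deriv i f u * g u + partial_deriv i g u * f u) (at (u i))" if "i < n" "u \<in> U" for i u
      using DERIV_mult[OF Ck_on_DERIV[OF Suc.prems(1) that] Ck_on_DERIV[OF Suc.prems(2) that]]
      by (simp only: fun_upd_triv)
  qed
qed

lemma Ck_on_sum:
  assumes "openin (Euclidean_space n) U" "\<And>j. j \<in> J \<Longrightarrow> Ck_on n k U (f j)"
  shows "Ck_on n k U (\<lambda>u. \<Sum>j\<in>J. f j u)"
  using assms(2)
proof (induction J rule: infinite_finite_induct)
  case (insert j J)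
  have "Ck_on n k U (\<lambda>u. f j u + (\<Sum>j\<in>J. f j u))"
    using insert by (intro Ck_on_add[OF assms(1)]) auto
  then show ?case
    using insert.hyps by simp
\<comment> \<open>For infinite \<open>J\<close> the sum is 0 by convention, so this case, like the
  empty one, is a constant.\<close>
qed (simp_all add: Ck_on_const[OF assms(1)])

section \<open>The chain rule\<close>

lemma tendsto_coordinatewise:
  fixes f :: "'c \<Rightarrow> 'b \<Rightarrow> 'd::topological_space"
  assumes "\<And>i. ((\<lambda>x. f x i) \<longlongrightarrow> l i) F"
  shows "(f \<longlongrightarrow> l) F"
proof -
  have "limitin (product_topology (\<lambda>i. euclidean) UNIV) f l F"
    using assms by (simp add: limitin_componentwise)
  then show ?thesis
    by (simp add: euclidean_product_topology)
qed

text \<open>Only the first \<open>m\<close> coordinates need a radius, because all later ones vanish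
  at both points; hence one positive radius serves in spite of the infinite product.\<close>

lemma Euclidean_space_open_contains_box:
  assumes "openin (Euclidean_space m) W" "w0 \<in> W"
  shows "\<exists>\<delta>>0. \<forall>w\<in>topspace (Euclidean_space m). (\<forall>i<m. \<bar>w i - w0 i\<bar> < \<delta>) \<longrightarrow> w \<in> W"
proof -
  obtain T where T: "open T" "W = T \<inter> topspace (Euclidean_space m)"
    using assms openin_Euclidean_space_iff by blast
  have "openin (product_topology (\<lambda>i. euclidean) UNIV) T"
    using T(1) by (metis euclidean_product_topology open_openin)
  then obtain X where X: "w0 \<in> Pi\<^sub>E UNIV X" "\<And>i. open (X i)" "Pi\<^sub>E UNIV X \<subseteq> T"
    using product_topology_open_contains_basis[of "\<lambda>i. euclidean" UNIV T w0] assms T by auto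
  have "\<exists>d>0. ball (w0 i) d \<subseteq> X i" for i
    using X(1,2) open_contains_ball[of "X i"] by (auto simp: PiE_def Pi_def)
  then obtain d where d: "\<And>i. d i > 0" "\<And>i. ball (w0 i) (d i) \<subseteq> X i"
    by metis
  \<comment> \<open>The element 1 keeps the minimum meaningful when \<open>m = 0\<close>.\<close>
  define \<delta> where "\<delta> = Min (insert 1 (d ` {..<m}))"
  have \<delta>: "\<delta> > 0" "\<And>i. i < m \<Longrightarrow> \<delta> \<le> d i"
    unfolding \<delta>_def using d(1) by auto
  have "w \<in> W"
    if w: "w \<in> topspace (Euclidean_space m)" "\<forall>i<m. \<bar>w i - w0 i\<bar> < \<delta>" for w
  proof -
    have "w i \<in> X i" for i
    proof (cases "i < m")
      case True
      then have "w i \<in> ball (w0 i) (d i)"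
        using w(2) \<delta>(2) True by (force simp: dist_real_def abs_minus_commute)
      then show ?thesis
        using d(2) by blast
    next
      case False
      then have "w i = w0 i"
        using w(1) assms(2) T by (simp add: topspace_Euclidean_space)
      then show ?thesis
        using X(1) by auto
    qed
    then show "w \<in> W"
      using X(3) w(1) T(2) by auto
  qed
  then show ?thesis
    using \<delta>(1) by blast
qed

text \<open>The weak bounds absorb the case \<open>a = b\<close>, and their symmetric form hides the
  order of \<open>a\<close> and \<open>b\<close>, so the result can be applied to each coordinate
  without case distinctions.\<close>

lemma MVT_between:
  fixes f :: "real \<Rightarrow> real"
  assumes "\<And>x. \<bar>x - a\<bar> \<le> \<bar>b - a\<bar> \<Longrightarrow> (f has_real_derivative f' x) (at x)"
  shows "\<exists>x. \<bar>x - a\<bar> \<le> \<bar>b - a\<bar> \<and> f b - f a = f' x * (b - a)"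
proof -
  consider "a < b" | "a = b" | "b < a" by linarith
  then show ?thesis
  proof cases
    case 1
    obtain z where "a < z" "z < b" "f b - f a = (b - a) * f' z"
      using MVT2[OF 1, of f f'] assms 1 by auto
    then show ?thesis
      by (intro exI[of _ z]) auto
  next
    case 2
    then show ?thesis by auto
  next
    case 3
    obtain z where "b < z" "z < a" "f a - f b = (a - b) * f' z"
      using MVT2[OF 3, of f f'] assms 3 by auto
    then show ?thesis
      by (intro exI[of _ z]) (auto simp: algebra_simps)
  qed
qed

text \<open>Telescoping along the coordinate directions, with the mean value theorem in each of them.\<close>

lemma increment_partial_deriv:
  assumes W: "openin (Euclidean_space m) W" and w0: "w0 \<in> W" and G: "Ck_on m (Suc k) W G"
  shows "\<exists>\<delta>>0. \<forall>w\<in>topspace (Euclidean_space m). (\<forall>i<m. \<bar>w i - w0 i\<bar> < \<delta>) \<longrightarrow>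
       (\<exists>q. (\<forall>j<m. q j \<in> W \<and> (\<forall>i. \<bar>q j i - w0 i\<bar> \<le> \<bar>w i - w0 i\<bar>)) \<and>
           G w - G w0 = (\<Sum>j<m. partial_deriv j G (q j) * (w j - w0 j)))"
proof -
  obtain \<delta> where \<delta>: "\<delta> > 0"
    "\<forall>w\<in>topspace (Euclidean_space m). (\<forall>i<m. \<bar>w i - w0 i\<bar> < \<delta>) \<longrightarrow> w \<in> W"
    using Euclidean_space_open_contains_box[OF W w0] by blast
  show ?thesis
  proof (intro exI[of _ \<delta>] conjI \<delta>(1) ballI impI)
    fix w assume w: "w \<in> topspace (Euclidean_space m)" "\<forall>i<m. \<bar>w i - w0 i\<bar> < \<delta>"
    \<comment> \<open>\<open>p j\<close> has already exchanged the first \<open>j\<close>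
      coordinates of \<open>w0\<close> for those of \<open>w\<close>; consecutive points differ in
      one coordinate.\<close>
    define p where "p j = (\<lambda>i. if i < j then w i else w0 i)" for j :: nat
    have w0E: "w0 \<in> topspace (Euclidean_space m)"
      using W w0 openin_subset by blast
    have inW: "(p j)(j := s) \<in> W" if "j < m" "\<bar>s - w0 j\<bar> \<le> \<bar>w j - w0 j\<bar>" for j s
    proof (rule \<delta>(2)[rule_format])
      show "(p j)(j := s) \<in> topspace (Euclidean_space m)"
        using w(1) w0E that by (auto simp: p_def topspace_Euclidean_space)
      show "\<bar>((p j)(j := s)) i - w0 i\<bar> < \<delta>" if "i < m" for i
        using w(2)[rule_format, OF that] \<delta>(1) \<open>\<bar>s - w0 j\<bar> \<le> \<bar>w j - w0 j\<bar>\<close> by (auto simp: p_def)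
    qed
    have "\<exists>s. \<bar>s - w0 j\<bar> \<le> \<bar>w j - w0 j\<bar> \<and>
        G ((p j)(j := w j)) - G ((p j)(j := w0 j)) = partial_deriv j G ((p j)(j := s)) * (w j - w0 j)"
      if j: "j < m" for j
    proof (rule MVT_between)
      fix s assume "\<bar>s - w0 j\<bar> \<le> \<bar>w j - w0 j\<bar>"
      from Ck_on_DERIV[OF G j inW[OF j this]]
      show "((\<lambda>s. G ((p j)(j := s))) has_real_derivative partial_deriv j G ((p j)(j := s))) (at s)"
        by simp
    qed
    then obtain s where s: "\<And>j. j < m \<Longrightarrow> \<bar>s j - w0 j\<bar> \<le> \<bar>w j - w0 j\<bar>"
      "\<And>j. j < m \<Longrightarrow> G ((p j)(j := w j)) - G ((p j)(j := w0 j)) =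
         partial_deriv j G ((p j)(j := s j)) * (w j - w0 j)"
      by metis
    have "p 0 = w0" "p m = w" "\<And>j. (p j)(j := w j) = p (Suc j)" "\<And>j. (p j)(j := w0 j) = p j"
      using w(1) w0E by (auto simp: p_def topspace_Euclidean_space fun_eq_iff less_Suc_eq)
    then have "G w - G w0 = (\<Sum>j<m. partial_deriv j G ((p j)(j := s j)) * (w j - w0 j))"
      using s(2) sum_lessThan_telescope[of "\<lambda>j. G (p j)" m] by simp
    \<comment> \<open>The coordinatewise bound, beyond membership in \<open>W\<close>, is what later
      forces the intermediate points to \<open>w0\<close> as \<open>w\<close> tends to
      \<open>w0\<close>.\<close>
    moreover have "\<forall>j<m. (p j)(j := s j) \<in> W \<and> (\<forall>i. \<bar>((p j)(j := s j)) i - w0 i\<bar> \<le> \<bar>w i - w0 i\<bar>)"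
      using inW s(1) by (auto simp: p_def)
    ultimately show "\<exists>q. (\<forall>j<m. q j \<in> W \<and> (\<forall>i. \<bar>q j i - w0 i\<bar> \<le> \<bar>w i - w0 i\<bar>)) \<and>
        G w - G w0 = (\<Sum>j<m. partial_deriv j G (q j) * (w j - w0 j))"
      by (intro exI[of _ "\<lambda>j. (p j)(j := s j)"]) blast
  qed
qed

text \<open>Divided by \<open>t - t0\<close>, the telescoped increment is a finite sum of partial
  derivatives at intermediate points times difference quotients of the coordinates, and continuity
  of the partial derivatives yields the limit. Curves are the right generality, since a partial
  derivative moves a single variable.\<close>

lemma DERIV_chain_partial_deriv:
  fixes c :: "real \<Rightarrow> nat \<Rightarrow> real"
  assumes W: "openin (Euclidean_space m) W" and G: "Ck_on m (Suc k) W G" and c0: "c t0 \<in> W"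
    and cE: "\<forall>\<^sub>F t in at t0. c t \<in> topspace (Euclidean_space m)"
    and c': "\<And>j. j < m \<Longrightarrow> ((\<lambda>t. c t j) has_real_derivative c' j) (at t0)"
  shows "((\<lambda>t. G (c t)) has_real_derivative (\<Sum>j<m. partial_deriv j G (c t0) * c' j)) (at t0)"
proof -
  define w0 where "w0 = c t0"
  have w0: "w0 \<in> W"
    using c0 by (simp add: w0_def)
  obtain \<delta> where \<delta>: "\<delta> > 0"
    "\<forall>w\<in>topspace (Euclidean_space m). (\<forall>i<m. \<bar>w i - w0 i\<bar> < \<delta>) \<longrightarrow>
       (\<exists>q. (\<forall>j<m. q j \<in> W \<and> (\<forall>i. \<bar>q j i - w0 i\<bar> \<le> \<bar>w i - w0 i\<bar>)) \<and>
           G w - G w0 = (\<Sum>j<m. partial_deriv j G (q j) * (w j - w0 j)))"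
    using increment_partial_deriv[OF W w0 G] by (elim exE conjE)
  define Q where "Q t q \<longleftrightarrow> (\<forall>j<m. q j \<in> W \<and> (\<forall>i. \<bar>q j i - w0 i\<bar> \<le> \<bar>c t i - w0 i\<bar>)) \<and>
           G (c t) - G w0 = (\<Sum>j<m. partial_deriv j G (q j) * (c t j - w0 j))" for t q
  \<comment> \<open>The intermediate points are picked arbitrarily for each \<open>t\<close>; the
    bounds recorded in \<open>Q\<close> alone determine their limit.\<close>
  define q where "q t = (SOME q. Q t q)" for t
  have lim: "((\<lambda>t. c t j) \<longlongrightarrow> w0 j) (at t0)" if "j < m" for j
    using DERIV_isCont[OF c'[OF that]] by (simp add: isCont_def w0_def)
  have "\<forall>\<^sub>F t in at t0. \<forall>j<m. \<bar>c t j - w0 j\<bar> < \<delta>"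
  proof -
    have "\<forall>\<^sub>F t in at t0. \<forall>j\<in>{..<m}. \<bar>c t j - w0 j\<bar> < \<delta>"
      using tendstoD[OF lim \<delta>(1)] by (intro eventually_ball_finite) (auto simp: dist_real_def)
    then show ?thesis
      by (simp only: Ball_def lessThan_iff)
  qed
  then have evQ: "\<forall>\<^sub>F t in at t0. Q t (q t)"
    using cE
  proof eventually_elim
    case (elim t)
    then have "\<exists>q. Q t q"
      unfolding Q_def using \<delta>(2)[rule_format, of "c t"] by blast
    then show ?case
      unfolding q_def by (rule someI_ex)
  qed
  have qlim: "((\<lambda>t. q t j) \<longlongrightarrow> w0) (at t0)" if j: "j < m" for j
  proof (rule tendsto_coordinatewise)
    fix i
    have "((\<lambda>t. c t i - w0 i) \<longlongrightarrow> 0) (at t0)"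
    proof (cases "i < m")
      case True
      then show ?thesis using LIM_zero[OF lim] by blast
    next
      case False
      \<comment> \<open>Beyond the dimension no derivative is assumed, but these coordinates are
        constantly 0 near \<open>t0\<close>.\<close>
      have "w0 i = 0"
        using False c0 openin_subset[OF W] unfolding w0_def by (auto simp: topspace_Euclidean_space)
      moreover have "\<forall>\<^sub>F t in at t0. c t i = 0"
        using cE by eventually_elim (use False in \<open>simp add: topspace_Euclidean_space\<close>)
      ultimately show ?thesis
        by (intro tendsto_eventually) (auto elim: eventually_mono)
    qed
    moreover have "\<forall>\<^sub>F t in at t0. norm (q t j i - w0 i) \<le> norm (c t i - w0 i)"
      using evQ by eventually_elim (use j in \<open>simp add: Q_def\<close>)
    ultimately have "((\<lambda>t. q t j i - w0 i) \<longlongrightarrow> 0) (at t0)"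
      by (rule Lim_transform_bound[rotated])
    then show "((\<lambda>t. q t j i) \<longlongrightarrow> w0 i) (at t0)"
      by (rule LIM_zero_cancel)
  qed
  have "((\<lambda>t. partial_deriv j G (q t j)) \<longlongrightarrow> partial_deriv j G w0) (at t0)" if j: "j < m" for j
  proof (rule continuous_on_tendsto_compose[OF _ qlim[OF j]])
    show "continuous_on W (partial_deriv j G)"
      using G j openin_subset[OF W] by (auto intro: Ck_on_continuous)
    show "\<forall>\<^sub>F t in at t0. q t j \<in> W"
      using evQ by eventually_elim (use j in \<open>simp add: Q_def\<close>)
  qed (use c0 w0_def in simp)
  moreover have "((\<lambda>t. (c t j - w0 j) / (t - t0)) \<longlongrightarrow> c' j) (at t0)" if "j < m" for j
    using c'[OF that] by (simp add: has_field_derivative_iff w0_def)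
  ultimately have
    "((\<lambda>t. \<Sum>j<m. partial_deriv j G (q t j) * ((c t j - w0 j) / (t - t0))) \<longlongrightarrow>
      (\<Sum>j<m. partial_deriv j G w0 * c' j)) (at t0)"
    by (intro tendsto_sum tendsto_mult) auto
  moreover have "\<forall>\<^sub>F t in at t0. (\<Sum>j<m. partial_deriv j G (q t j) * ((c t j - w0 j) / (t - t0))) =
      (G (c t) - G (c t0)) / (t - t0)"
    using evQ by eventually_elim (simp add: Q_def w0_def sum_divide_distrib)
  ultimately show ?thesis
    unfolding has_field_derivative_iff using tendsto_cong w0_def by force
qed

text \<open>A partial derivative of the composite is a sum of products, in which
  \<open>partial_deriv j G (F u)\<close> is again a composite with the same \<open>F\<close>. Hence
  \<open>G\<close> varies in the induction while \<open>F\<close> stays fixed.\<close>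

lemma Ck_on_compose:
  assumes U: "openin (Euclidean_space n) U" and W: "openin (Euclidean_space m) W"
    and F: "\<And>u. u \<in> U \<Longrightarrow> F u \<in> W"
  shows "Ck_on m k W G \<Longrightarrow> (\<And>j. j < m \<Longrightarrow> Ck_on n k U (\<lambda>u. F u j)) \<Longrightarrow> Ck_on n k U (\<lambda>u. G (F u))"
proof (induction k arbitrary: G)
  case 0
  \<comment> \<open>The hypothesis covers the first \<open>m\<close> coordinates; the others vanish
    because \<open>F\<close> maps into \<open>W\<close>.\<close>
  have "continuous_on U (\<lambda>u. F u j)" for j
  proof (cases "j < m")
    case True
    then show ?thesis
      using Ck_on_continuous[OF 0(2) openin_subset[OF U]] by blast
  next
    case False
    then have "F u j = 0" if "u \<in> U" for u
      using F[OF that] openin_subset[OF W] by (auto simp: topspace_Euclidean_space)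
    then show ?thesis
      by (simp cong: continuous_on_cong)
  qed
  then have "continuous_on U F"
    by (rule continuous_on_coordinatewise_then_product)
  then show ?case
    using 0(1) F continuous_on_compose2[of W G U F]
    by (simp add: Ck_on_0 openin_subset U W image_subset_iff del: Ck_on.simps)
next
  case (Suc k)
  have F_Suc: "Ck_on n (Suc k) U (\<lambda>u. F u j)" if "j < m" for j
    using Suc.prems(2) that by blast
  show ?case
  proof (rule Ck_on_SucI[OF U,
        where f' = "\<lambda>i u. \<Sum>j<m. partial_deriv j G (F u) * partial_deriv i (\<lambda>u. F u j) u"])
    have "Ck_on n k U (\<lambda>u. G (F u))"
      by (rule Suc.IH[OF Ck_on_SucD[OF Suc.prems(1)] Ck_on_SucD[OF F_Suc]])
    then show "continuous_on U (\<lambda>u. G (F u))"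
      using openin_subset[OF U] by (rule Ck_on_continuous)
    show "Ck_on n k U (\<lambda>u. \<Sum>j<m. partial_deriv j G (F u) * partial_deriv i (\<lambda>u. F u j) u)"
      if i: "i < n" for i
    proof (rule Ck_on_sum[OF U])
      fix j assume "j \<in> {..<m}"
      then have j: "j < m" by simp
      have "Ck_on n k U (\<lambda>u. partial_deriv j G (F u))"
        by (rule Suc.IH[OF _ Ck_on_SucD[OF F_Suc]]) (use Suc.prems(1) j in simp_all)
      then show "Ck_on n k U (\<lambda>u. partial_deriv j G (F u) * partial_deriv i (\<lambda>u. F u j) u)"
        using F_Suc[OF j] i by (intro Ck_on_mult[OF U]) simp_all
    qed
    show "((\<lambda>t. G (F (u(i := t)))) has_real_derivative
        (\<Sum>j<m. partial_deriv j G (F u) * partial_deriv i (\<lambda>u. F u j) u)) (at (u i))"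
      if i: "i < n" and u: "u \<in> U" for i u
    proof -
      have "\<forall>\<^sub>F t in nhds (u i). F (u(i := t)) \<in> topspace (Euclidean_space m)"
        using eventually_fun_upd_in_open[OF U u i]
        by eventually_elim (use F openin_subset[OF W] in blast)
      then have "((\<lambda>t. G (F (u(i := t)))) has_real_derivative
        (\<Sum>j<m. partial_deriv j G (F (u(i := u i))) * partial_deriv i (\<lambda>u. F u j) u)) (at (u i))"
        by (intro DERIV_chain_partial_deriv[OF W Suc.prems(1)] Ck_on_DERIV[OF F_Suc i u])
          (use F u in \<open>auto simp: eventually_at_filter elim: eventually_mono\<close>)
      then show ?thesis
        by simp
    qed
  qed
qed

section \<open>Smooth functions of several variables and of one variable\<close>

lemma smooth_on_compose:
  assumes "openin (Euclidean_space n) U" "openin (Euclidean_space m) W" "smooth_on m W G"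
    and "\<And>j. j < m \<Longrightarrow> smooth_on n U (\<lambda>u. F u j)" and "\<And>u. u \<in> U \<Longrightarrow> F u \<in> W"
  shows "smooth_on n U (\<lambda>u. G (F u))"
  using assms Ck_on_compose[of n U m W F] unfolding smooth_on_def by blast

lemma smooth_on_const: "openin (Euclidean_space n) U \<Longrightarrow> smooth_on n U (\<lambda>_. c)"
  by (simp add: smooth_on_def Ck_on_const)

lemma smooth_on_coordinate: "openin (Euclidean_space n) U \<Longrightarrow> smooth_on n U (\<lambda>u. u j)"
  by (simp add: smooth_on_def Ck_on_coordinate)

lemma smooth_on_add:
  "openin (Euclidean_space n) U \<Longrightarrow> smooth_on n U f \<Longrightarrow> smooth_on n U g \<Longrightarrow> smooth_on n U (\<lambda>u. f u + g u)"
  by (simp add: smooth_on_def Ck_on_add)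

lemma smooth_on_mult:
  "openin (Euclidean_space n) U \<Longrightarrow> smooth_on n U f \<Longrightarrow> smooth_on n U g \<Longrightarrow> smooth_on n U (\<lambda>u. f u * g u)"
  by (simp add: smooth_on_def Ck_on_mult)

lemma smooth_on_cong:
  "openin (Euclidean_space n) U \<Longrightarrow> smooth_on n U g \<Longrightarrow> (\<And>u. u \<in> U \<Longrightarrow> f u = g u) \<Longrightarrow> smooth_on n U f"
  unfolding smooth_on_def using Ck_on_cong by blast

lemma smooth_on_local:
  assumes U: "openin (Euclidean_space n) U"
    and loc: "\<And>u. u \<in> U \<Longrightarrow> \<exists>V g. openin (Euclidean_space n) V \<and> u \<in> V \<and> smooth_on n V g \<and> (\<forall>v\<in>V. f v = g v)"
  shows "smooth_on n U f"
  unfolding smooth_on_def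
proof
  fix k
  show "Ck_on n k U f"
  proof (rule Ck_on_local[OF U])
    fix u assume "u \<in> U"
    from loc[OF this] show "\<exists>V g. openin (Euclidean_space n) V \<and> u \<in> V \<and> Ck_on n k V g \<and> (\<forall>v\<in>V. f v = g v)"
      unfolding smooth_on_def by blast
  qed
qed

lemma continuous_map_Euclidean_coordinate:
  "continuous_map (Euclidean_space n) euclideanreal (\<lambda>u. u j)"
  using continuous_map_Euclidean_subspace_iff[of n "topspace (Euclidean_space n)" "\<lambda>u. u j"]
    continuous_on_subset[OF continuous_on_product_coordinates subset_UNIV]
  by (metis subtopology_topspace)

lemma openin_Euclidean_line:
  assumes "open S"
  shows "openin (Euclidean_space 1) {u \<in> topspace (Euclidean_space 1). u 0 \<in> S}"
  by (rule openin_continuous_map_preimage[OF continuous_map_Euclidean_coordinate])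
    (use assms open_openin in blast)

text \<open>A function \<open>g\<close> of one real variable is represented on
  \<open>Euclidean_space 1\<close> by reading coordinate 0. The set \<open>S\<close> admits outer
  functions with a restricted domain, such as the reciprocal on the positive half-line.\<close>

lemma smooth_on_compose_line:
  assumes U: "openin (Euclidean_space n) U" and S: "open S"
    and g: "smooth_on 1 {u \<in> topspace (Euclidean_space 1). u 0 \<in> S} (\<lambda>u. g (u 0))"
    and f: "smooth_on n U f" "\<And>u. u \<in> U \<Longrightarrow> f u \<in> S"
  shows "smooth_on n U (\<lambda>u. g (f u))"
proof -
  have "smooth_on n U (\<lambda>u. (\<lambda>w. g (w 0)) (\<lambda>i::nat. if i = 0 then f u else 0))"
  proof (rule smooth_on_compose[OF U openin_Euclidean_line[OF S] g,
        where F = "\<lambda>u i. if i = 0 then f u else 0"])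
    show "smooth_on n U (\<lambda>u. if j = 0 then f u else 0)" if "j < 1" for j :: nat
      using f(1) that by simp
  qed (simp add: f(2) topspace_Euclidean_space)
  then show ?thesis
    by simp
qed


section \<open>Flat functions and reciprocals\<close>

text \<open>The classical smooth function \<open>exp (- (1 / t))\<close>, extended by 0 to
  \<open>t \<le> 0\<close>, together with its quotients by powers of \<open>t\<close>; the quotients
  make the family closed under differentiation up to linear combinations.\<close>

definition flat :: "nat \<Rightarrow> real \<Rightarrow> real" where
  "flat m t = (if t > 0 then exp (- (1 / t)) / t ^ m else 0)"

text \<open>On the right, substituting \<open>1 / t\<close> turns the claim into the decay of
  \<open>x ^ m / exp x\<close> at infinity.\<close>

lemma flat_tendsto_0: "(flat m \<longlongrightarrow> 0) (at 0)"
proof (rule filterlim_split_at)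
  show "(flat m \<longlongrightarrow> 0) (at_left 0)"
    by (rule tendsto_eventually) (auto simp: flat_def eventually_at_left_field intro: exI[of _ "-1"])
  have "((\<lambda>t. (inverse t) ^ m / exp (inverse t)) \<longlongrightarrow> 0) (at_right (0::real))"
    by (rule filterlim_compose[OF tendsto_power_div_exp_0 filterlim_inverse_at_top_right])
  moreover have "\<forall>\<^sub>F t in at_right 0. inverse t ^ m / exp (inverse t) = flat m t"
    by (auto simp: eventually_at_right_field flat_def exp_minus field_simps intro: exI[of _ 1])
  ultimately show "(flat m \<longlongrightarrow> 0) (at_right 0)"
    by (simp cong: tendsto_cong add: tendsto_cong)
qed

lemma DERIV_flat:
  "(flat m has_real_derivative flat (m + 2) t - real m * flat (m + 1) t) (at t)"
proof -
  consider "t > 0" | "t < 0" | "t = 0" by linarith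
  then show ?thesis
  proof cases
    case 1
    have "((\<lambda>t. exp (- (1 / t)) / t ^ m) has_real_derivative
        (exp (- (1 / t)) * (1 / t\<^sup>2) * t ^ m - exp (- (1 / t)) * (real m * t ^ (m - 1))) / (t ^ m * t ^ m)) (at t)"
      using 1 by (auto intro!: derivative_eq_intros simp: power2_eq_square)
    also have "(exp (- (1 / t)) * (1 / t\<^sup>2) * t ^ m - exp (- (1 / t)) * (real m * t ^ (m - 1))) / (t ^ m * t ^ m)
        = flat (m + 2) t - real m * flat (m + 1) t"
      using 1 by (cases m) (simp_all add: flat_def field_simps power2_eq_square)
    finally have "((\<lambda>t. exp (- (1 / t)) / t ^ m) has_real_derivative
        flat (m + 2) t - real m * flat (m + 1) t) (at t)" .
    then show ?thesis
    proof (rule has_field_derivative_transform_within_open)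
      show "exp (- (1 / s)) / s ^ m = flat m s" if "s \<in> {0<..}" for s
        using that by (simp add: flat_def)
    qed (use 1 in auto)
  next
    case 2
    have "((\<lambda>t. 0) has_real_derivative 0) (at t)"
      by simp
    then have "(flat m has_real_derivative 0) (at t)"
    proof (rule has_field_derivative_transform_within_open)
      show "0 = flat m s" if "s \<in> {..<0}" for s
        using that by (simp add: flat_def)
    qed (use 2 in auto)
    then show ?thesis
      using 2 by (simp add: flat_def)
  next
    case 3
    \<comment> \<open>The difference quotient at 0 is again a member of the family; at
      \<open>s = 0\<close> both sides are 0, since division by 0 gives 0.\<close>
    have "(\<lambda>s. (flat m s - flat m 0) / (s - 0)) = flat (m + 1)"
      by (auto simp: flat_def fun_eq_iff)
    then show ?thesis
      using flat_tendsto_0[of "m + 1"] unfolding 3 has_field_derivative_iff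
      by (simp add: flat_def[of _ 0])
  qed
qed

text \<open>Differentiation raises the exponent, so the induction on the order runs over all
  \<open>m\<close> at once. The condition with \<open>UNIV\<close> matches the form of the domain in
  \<open>smooth_on_compose_line\<close>.\<close>

lemma smooth_on_flat: "smooth_on 1 {u \<in> topspace (Euclidean_space 1). u 0 \<in> UNIV} (\<lambda>u. flat m (u 0))"
  unfolding smooth_on_def
proof
  fix k
  let ?U = "{u \<in> topspace (Euclidean_space 1). u 0 \<in> UNIV}"
  have U: "openin (Euclidean_space 1) ?U"
    by (rule openin_Euclidean_line) simp
  have cont: "continuous_on ?U (\<lambda>u. flat m (u 0))" for m
  proof (rule continuous_on_compose2[where g = "flat m"])
    show "continuous_on UNIV (flat m)"
      using DERIV_isCont[OF DERIV_flat] by (simp add: continuous_at_imp_continuous_on)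
    show "continuous_on ?U (\<lambda>u. u 0)"
      by (rule continuous_on_subset[OF continuous_on_product_coordinates subset_UNIV])
  qed simp
  show "Ck_on 1 k ?U (\<lambda>u. flat m (u 0))"
  proof (induction k arbitrary: m)
    case 0
    then show ?case
      using cont[of m] Ck_on_0[OF openin_subset[OF U]] by blast
  next
    case (Suc k)
    show ?case
    proof (rule Ck_on_SucI[OF U cont,
          where f' = "\<lambda>i u. flat (m + 2) (u 0) + (- real m) * flat (m + 1) (u 0)"])
      show "Ck_on 1 k ?U (\<lambda>u. flat (m + 2) (u 0) + (- real m) * flat (m + 1) (u 0))"
        by (rule Ck_on_add[OF U Suc.IH Ck_on_mult[OF U Ck_on_const[OF U] Suc.IH]])
    next
      fix i :: nat and u :: "nat \<Rightarrow> real" assume "i < 1"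
      then show "((\<lambda>t. flat m ((u(i := t)) 0)) has_real_derivative
          flat (m + 2) (u 0) + - real m * flat (m + 1) (u 0)) (at (u i))"
        using DERIV_flat[of m "u 0"] by simp
    qed
  qed
qed

text \<open>The derivative is minus the square of the function itself, so the product rule closes
  the induction.\<close>

lemma smooth_on_inverse: "smooth_on 1 {u \<in> topspace (Euclidean_space 1). u 0 \<in> {0<..}} (\<lambda>u. inverse (u 0))"
  unfolding smooth_on_def
proof
  fix k
  let ?U = "{u \<in> topspace (Euclidean_space 1). u 0 \<in> {0::real<..}}"
  have U: "openin (Euclidean_space 1) ?U"
    by (rule openin_Euclidean_line) simp
  have cont: "continuous_on ?U (\<lambda>u. inverse (u 0))"
    by (intro continuous_on_inverse continuous_on_subset[OF continuous_on_product_coordinates subset_UNIV])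
      auto
  show "Ck_on 1 k ?U (\<lambda>u. inverse (u 0))"
  proof (induction k)
    case 0
    then show ?case
      using cont Ck_on_0[OF openin_subset[OF U]] by blast
  next
    case (Suc k)
    show ?case
    proof (rule Ck_on_SucI[OF U cont, where f' = "\<lambda>i u. (- 1) * (inverse (u 0) * inverse (u 0))"])
      show "Ck_on 1 k ?U (\<lambda>u. (- 1) * (inverse (u 0) * inverse (u 0)))"
        by (rule Ck_on_mult[OF U Ck_on_const[OF U] Ck_on_mult[OF U Suc.IH Suc.IH]])
    next
      fix i :: nat and u :: "nat \<Rightarrow> real" assume "i < 1" "u \<in> ?U"
      then show "((\<lambda>t. inverse ((u(i := t)) 0)) has_real_derivative
          (- 1) * (inverse (u 0) * inverse (u 0))) (at (u i))"
        by (auto intro!: derivative_eq_intros simp: divide_inverse)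
    qed
  qed
qed

text \<open>The flat summand makes the denominator positive everywhere, and it vanishes for \<open>s\<^sup>2 \<ge> a\<close>.\<close>

lemma smooth_on_regularized_reciprocal:
  assumes "a > 0"
  shows "smooth_on 1 (topspace (Euclidean_space 1))
    (\<lambda>u. inverse (u 0 * u 0 + flat 0 (a + (- 1) * (u 0 * u 0))))"
proof (rule smooth_on_compose_line[OF _ _ smooth_on_inverse])
  show U: "openin (Euclidean_space 1) (topspace (Euclidean_space 1))"
    by simp
  have sq: "smooth_on 1 (topspace (Euclidean_space 1)) (\<lambda>u. u 0 * u 0)"
    by (intro smooth_on_mult smooth_on_coordinate U)
  have "smooth_on 1 (topspace (Euclidean_space 1)) (\<lambda>u. flat 0 (a + (- 1) * (u 0 * u 0)))"
    by (rule smooth_on_compose_line[OF U open_UNIV smooth_on_flat])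
      (intro smooth_on_add[OF U] smooth_on_mult[OF U] smooth_on_const[OF U] smooth_on_coordinate[OF U] UNIV_I)+
  with sq show "smooth_on 1 (topspace (Euclidean_space 1))
      (\<lambda>u. u 0 * u 0 + flat 0 (a + (- 1) * (u 0 * u 0)))"
    by (rule smooth_on_add[OF U])
  show "u 0 * u 0 + flat 0 (a + (- 1) * (u 0 * u 0)) \<in> {0<..}" for u :: "nat \<Rightarrow> real"
  proof (cases "u 0 = 0")
    case False
    then have "u 0 * u 0 > 0"
      using not_real_square_gt_zero by blast
    then show ?thesis
      by (simp add: flat_def add_pos_nonneg)
  qed (use assms in \<open>simp add: flat_def\<close>)
qed simp

text \<open>Germ-definedness lets the cut-off level \<open>a\<close> depend on the point, as it must
  when \<open>f\<close> is not globally bounded away from 0.\<close>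

lemma Cinf_ring_reciprocal:
  assumes C: "continuous_subalgebra T C" "Cinf_ring C" "germ_defined T C"
    and f: "f \<in> C" "\<And>x. x \<in> topspace T \<Longrightarrow> f x \<noteq> 0"
  shows "(\<lambda>x. 1 / f x) \<in> C"
proof -
  have mult: "(\<lambda>x. g x * h x) \<in> C" if "g \<in> C" "h \<in> C" for g h
    using C(1) that unfolding continuous_subalgebra_def by blast
  have "(\<lambda>x. 1 / f x) \<in> sheaf_sections T C (topspace T)"
    unfolding sheaf_sections_def
  proof (intro CollectI ballI)
    fix p assume p: "p \<in> topspace T"
    \<comment> \<open>Positive, so that the regularized denominator never vanishes, and below
      \<open>f p * f p\<close>, so that \<open>p\<close> lies in the open set where the flat summand
      is 0.\<close>
    define a where "a = f p * f p / 2"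
    have a: "0 < a" "a < f p * f p"
      using f(2)[OF p] by (auto simp: a_def zero_less_mult_iff linorder_neq_iff)
    define g where "g x = f x * inverse (f x * f x + flat 0 (a + (- 1) * (f x * f x)))" for x
    let ?G = "\<lambda>u. inverse (u 0 * u 0 + flat 0 (a + (- 1) * (u 0 * u 0)))"
    have "(\<lambda>x. ?G (\<lambda>i::nat. if i < 1 then f x else 0)) \<in> C"
      using C(2)[unfolded Cinf_ring_def, rule_format, of 1 ?G "\<lambda>_. f"]
        smooth_on_regularized_reciprocal[OF a(1)] f(1) by blast
    then have "(\<lambda>x. inverse (f x * f x + flat 0 (a + (- 1) * (f x * f x)))) \<in> C"
      by (simp only: less_one simp_thms if_True)
    then have "g \<in> C"
      unfolding g_def by (rule mult[OF f(1)])
    define V where "V = {x \<in> topspace T. f x * f x \<in> {a<..}}"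
    have "continuous_map T euclideanreal (\<lambda>x. f x * f x)"
      using C(1) f(1) unfolding continuous_subalgebra_def by (intro continuous_map_real_mult) blast+
    then have "openin T V"
      unfolding V_def by (rule openin_continuous_map_preimage) (rule open_openin[THEN iffD1, OF open_greaterThan])
    \<comment> \<open>On \<open>V\<close> the argument of \<open>flat\<close> is negative, and
      \<open>g\<close> reduces to \<open>f / f\<^sup>2\<close>.\<close>
    moreover have "1 / f x = g x" if "x \<in> V" for x
      using that f(2)[of x] by (simp add: V_def g_def flat_def divide_inverse)
    ultimately show "\<exists>V g. openin T V \<and> p \<in> V \<and> V \<subseteq> topspace T \<and> g \<in> C \<and> (\<forall>q\<in>V. 1 / f q = g q)"
      using \<open>g \<in> C\<close> p a(2) by (intro exI[of _ V] exI[of _ g]) (auto simp: V_def)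
  qed
  then show ?thesis
    using C(3) by (auto simp: germ_defined_def)
qed

section \<open>Smooth functions in charts\<close>

text \<open>The part of the manifold axioms that the smooth functions of a single chart depend on.\<close>

definition locally_parametrized :: "'a mfd \<Rightarrow> bool" where
  "locally_parametrized M \<longleftrightarrow>
     (\<forall>p\<in>mfd_points M. \<exists>D \<psi>. (D, \<psi>) \<in> mfd_charts M \<and> p \<in> D) \<and>
     (\<forall>D \<psi>. (D, \<psi>) \<in> mfd_charts M \<longrightarrow>
        openin (mfd_top M) D \<and> inj_on \<psi> D \<and> openin (Euclidean_space (mfd_dim M)) (\<psi> ` D) \<and>
        continuous_map (subtopology (Euclidean_space (mfd_dim M)) (\<psi> ` D)) (mfd_top M) (inv_into D \<psi>))"

lemma locally_parametrizedI:
  assumes "\<And>p. p \<in> mfd_points M \<Longrightarrow> \<exists>D \<psi>. (D, \<psi>) \<in> mfd_charts M \<and> p \<in> D"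
    and "\<And>D \<psi>. (D, \<psi>) \<in> mfd_charts M \<Longrightarrow> openin (mfd_top M) D"
    and "\<And>D \<psi>. (D, \<psi>) \<in> mfd_charts M \<Longrightarrow> inj_on \<psi> D"
    and "\<And>D \<psi>. (D, \<psi>) \<in> mfd_charts M \<Longrightarrow> openin (Euclidean_space (mfd_dim M)) (\<psi> ` D)"
    and "\<And>D \<psi>. (D, \<psi>) \<in> mfd_charts M \<Longrightarrow>
      continuous_map (subtopology (Euclidean_space (mfd_dim M)) (\<psi> ` D)) (mfd_top M) (inv_into D \<psi>)"
  shows "locally_parametrized M"
  unfolding locally_parametrized_def by (intro conjI ballI allI impI assms)

lemma locally_parametrized_chart:
  assumes "locally_parametrized M" "(D, \<psi>) \<in> mfd_charts M"
  shows "openin (mfd_top M) D" "inj_on \<psi> D" "openin (Euclidean_space (mfd_dim M)) (\<psi> ` D)"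
    and "continuous_map (subtopology (Euclidean_space (mfd_dim M)) (\<psi> ` D)) (mfd_top M) (inv_into D \<psi>)"
  using assms unfolding locally_parametrized_def by auto

lemma locally_parametrized_cover:
  assumes "locally_parametrized M" "p \<in> mfd_points M"
  obtains D \<psi> where "(D, \<psi>) \<in> mfd_charts M" "p \<in> D"
  using assms unfolding locally_parametrized_def by blast

text \<open>The coordinate picture of an open set is its preimage under the inverse chart, and the
  continuity of that inverse is part of \<open>locally_parametrized\<close>.\<close>

lemma openin_chart_image:
  assumes "locally_parametrized M" "(D, \<psi>) \<in> mfd_charts M" "openin (mfd_top M) O'"
  shows "openin (Euclidean_space (mfd_dim M)) {w \<in> \<psi> ` D. inv_into D \<psi> w \<in> O'}"
proof -
  note chart = locally_parametrized_chart[OF assms(1,2)]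
  have "openin (subtopology (Euclidean_space (mfd_dim M)) (\<psi> ` D))
      {w \<in> topspace (subtopology (Euclidean_space (mfd_dim M)) (\<psi> ` D)). inv_into D \<psi> w \<in> O'}"
    by (rule openin_continuous_map_preimage[OF chart(4) assms(3)])
  moreover have "topspace (subtopology (Euclidean_space (mfd_dim M)) (\<psi> ` D)) = \<psi> ` D"
    by (rule topspace_subtopology_subset[OF openin_subset[OF chart(3)]])
  ultimately show ?thesis
    using openin_trans_full[OF _ chart(3)] by metis
qed

lemma openin_chart_image_Int:
  assumes "locally_parametrized M" "(D, \<psi>) \<in> mfd_charts M" "openin (mfd_top M) O'"
  shows "openin (Euclidean_space (mfd_dim M)) (\<psi> ` (D \<inter> O'))"
proof -
  have "\<psi> ` (D \<inter> O') = {w \<in> \<psi> ` D. inv_into D \<psi> w \<in> O'}"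
    using locally_parametrized_chart(2)[OF assms(1,2)] by (auto simp: inv_into_f_f)
  then show ?thesis
    using openin_chart_image[OF assms] by simp
qed

lemma smooth_funsI:
  "(\<And>D \<psi>. (D, \<psi>) \<in> mfd_charts M \<Longrightarrow> smooth_on (mfd_dim M) (\<psi> ` D) (f \<circ> inv_into D \<psi>)) \<Longrightarrow> f \<in> smooth_funs M"
  unfolding smooth_funs_def by blast

lemma smooth_funsD:
  "f \<in> smooth_funs M \<Longrightarrow> (D, \<psi>) \<in> mfd_charts M \<Longrightarrow> smooth_on (mfd_dim M) (\<psi> ` D) (f \<circ> inv_into D \<psi>)"
  unfolding smooth_funs_def by blast

text \<open>A chart is a homeomorphism onto some open \<open>V\<close>. Surjectivity identifies
  \<open>V\<close> with the image of the chart, and the continuous inverse agrees there with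
  \<open>inv_into D \<psi>\<close>, the inverse used in \<open>smooth_funs\<close>.\<close>

lemma smooth_manifold_locally_parametrized:
  assumes "smooth_manifold M"
  shows "locally_parametrized M"
proof -
  have chart: "openin (mfd_top M) D \<and> inj_on \<psi> D \<and> openin (Euclidean_space (mfd_dim M)) (\<psi> ` D) \<and>
      continuous_map (subtopology (Euclidean_space (mfd_dim M)) (\<psi> ` D)) (mfd_top M) (inv_into D \<psi>)"
    if c: "(D, \<psi>) \<in> mfd_charts M" for D \<psi>
  proof -
    obtain V where D: "openin (mfd_top M) D" and V: "openin (Euclidean_space (mfd_dim M)) V"
      and hom: "homeomorphic_map (subtopology (mfd_top M) D) (subtopology (Euclidean_space (mfd_dim M)) V) \<psi>"
      using assms c unfolding smooth_manifold_def by blast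
    have topD: "topspace (subtopology (mfd_top M) D) = D"
      by (rule topspace_subtopology_subset[OF openin_subset[OF D]])
    have topV: "topspace (subtopology (Euclidean_space (mfd_dim M)) V) = V"
      by (rule topspace_subtopology_subset[OF openin_subset[OF V]])
    have inj: "inj_on \<psi> D"
      using homeomorphic_imp_injective_map[OF hom] unfolding topD .
    have im: "\<psi> ` D = V"
      using homeomorphic_imp_surjective_map[OF hom] unfolding topD topV .
    obtain g where g: "homeomorphic_maps (subtopology (mfd_top M) D) (subtopology (Euclidean_space (mfd_dim M)) V) \<psi> g"
      using hom homeomorphic_map_maps by blast
    have "continuous_map (subtopology (Euclidean_space (mfd_dim M)) V) (mfd_top M) g"
      using g unfolding homeomorphic_maps_def continuous_map_in_subtopology by blast
    moreover have "g w = inv_into D \<psi> w" if "w \<in> V" for w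
    proof -
      have "\<forall>x\<in>D. g (\<psi> x) = x"
        using g unfolding homeomorphic_maps_def topD by blast
      then show ?thesis
        using that im inj by (auto simp: inv_into_f_f)
    qed
    ultimately have "continuous_map (subtopology (Euclidean_space (mfd_dim M)) V) (mfd_top M) (inv_into D \<psi>)"
      using topV by (metis continuous_map_eq)
    then show ?thesis
      using D V inj im by simp
  qed
  have cover: "(\<Union>(D, \<psi>) \<in> mfd_charts M. D) = mfd_points M"
    using assms unfolding smooth_manifold_def by blast
  have "\<exists>D \<psi>. (D, \<psi>) \<in> mfd_charts M \<and> p \<in> D" if "p \<in> mfd_points M" for p
  proof -
    have "p \<in> (\<Union>(D, \<psi>) \<in> mfd_charts M. D)"
      using that cover by simp
    then obtain c where "c \<in> mfd_charts M" "p \<in> (case c of (D, \<psi>) \<Rightarrow> D)"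
      by blast
    then show ?thesis
      by (cases c) auto
  qed
  then show ?thesis
    unfolding locally_parametrized_def using chart by blast
qed

lemma smooth_funs_cong:
  assumes M: "locally_parametrized M" and g: "g \<in> smooth_funs M"
    and eq: "\<And>p. p \<in> mfd_points M \<Longrightarrow> f p = g p"
  shows "f \<in> smooth_funs M"
proof (rule smooth_funsI)
  fix D \<psi> assume c: "(D, \<psi>) \<in> mfd_charts M"
  note chart = locally_parametrized_chart[OF M c]
  show "smooth_on (mfd_dim M) (\<psi> ` D) (f \<circ> inv_into D \<psi>)"
  proof (rule smooth_on_cong[OF chart(3) smooth_funsD[OF g c]])
    fix w assume "w \<in> \<psi> ` D"
    then have "inv_into D \<psi> w \<in> mfd_points M"
      using inv_into_into[of w \<psi> D] openin_subset[OF chart(1)] by auto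
    then show "(f \<circ> inv_into D \<psi>) w = (g \<circ> inv_into D \<psi>) w"
      by (simp add: eq)
  qed
qed

lemma mfd_points_open_submfd: "openin (mfd_top M) B \<Longrightarrow> mfd_points (open_submfd M B) = B"
  by (simp add: open_submfd_def Int_absorb1 openin_subset)

lemma locally_parametrized_open_submfd:
  assumes M: "locally_parametrized M" and B: "openin (mfd_top M) B"
  shows "locally_parametrized (open_submfd M B)"
proof (rule locally_parametrizedI)
  fix p assume "p \<in> mfd_points (open_submfd M B)"
  then have p: "p \<in> mfd_points M" "p \<in> B"
    by (auto simp: open_submfd_def)
  obtain D \<psi> where "(D, \<psi>) \<in> mfd_charts M" "p \<in> D"
    using locally_parametrized_cover[OF M p(1)] .
  then show "\<exists>D \<psi>. (D, \<psi>) \<in> mfd_charts (open_submfd M B) \<and> p \<in> D"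
    using p(2) by (force simp: open_submfd_def)
next
  fix D' \<psi> assume "(D', \<psi>) \<in> mfd_charts (open_submfd M B)"
  then obtain D where c: "(D, \<psi>) \<in> mfd_charts M" and D': "D' = D \<inter> B"
    by (auto simp: open_submfd_def)
  note chart = locally_parametrized_chart[OF M c]
  show "openin (mfd_top (open_submfd M B)) D'"
    unfolding D' open_submfd_def using chart(1) by (auto simp: openin_subtopology)
  show "inj_on \<psi> D'"
    using chart(2) D' by (meson Int_lower1 inj_on_subset)
  show op: "openin (Euclidean_space (mfd_dim (open_submfd M B))) (\<psi> ` D')"
    using openin_chart_image_Int[OF M c B] by (simp add: D' open_submfd_def)
  \<comment> \<open>\<open>inv_into\<close> depends on the domain; injectivity on the larger set
    \<open>D\<close> makes both inverses agree on the image of \<open>D'\<close>.\<close>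
  have eq: "inv_into D \<psi> w = inv_into D' \<psi> w" "inv_into D \<psi> w \<in> B" if "w \<in> \<psi> ` D'" for w
    using that chart(2) D' by (auto simp: inv_into_f_f inj_on_Int)
  have "continuous_map (subtopology (Euclidean_space (mfd_dim M)) (\<psi> ` D')) (mfd_top M) (inv_into D \<psi>)"
    using continuous_map_from_subtopology_mono[OF chart(4), of "\<psi> ` D'"] D' by blast
  then have "continuous_map (subtopology (Euclidean_space (mfd_dim M)) (\<psi> ` D')) (subtopology (mfd_top M) B)
      (inv_into D \<psi>)"
    using eq(2) by (auto simp: continuous_map_in_subtopology)
  then show "continuous_map (subtopology (Euclidean_space (mfd_dim (open_submfd M B))) (\<psi> ` D'))
      (mfd_top (open_submfd M B)) (inv_into D' \<psi>)"
    using eq(1) by (auto simp: open_submfd_def intro: continuous_map_eq)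
qed

lemma smooth_funs_local:
  assumes M: "locally_parametrized M"
    and loc: "\<And>p. p \<in> mfd_points M \<Longrightarrow> \<exists>U. openin (mfd_top M) U \<and> p \<in> U \<and> f \<in> smooth_funs (open_submfd M U)"
  shows "f \<in> smooth_funs M"
proof (rule smooth_funsI)
  fix D \<psi> assume c: "(D, \<psi>) \<in> mfd_charts M"
  note chart = locally_parametrized_chart[OF M c]
  show "smooth_on (mfd_dim M) (\<psi> ` D) (f \<circ> inv_into D \<psi>)"
  proof (rule smooth_on_local[OF chart(3)])
    fix w assume "w \<in> \<psi> ` D"
    then obtain p where p: "p \<in> D" "w = \<psi> p" by blast
    obtain U where U: "openin (mfd_top M) U" "p \<in> U" "f \<in> smooth_funs (open_submfd M U)"
      using loc[of p] p(1) openin_subset[OF chart(1)] by blast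
    have cU: "(D \<inter> U, \<psi>) \<in> mfd_charts (open_submfd M U)"
      using c by (force simp: open_submfd_def)
    have "smooth_on (mfd_dim M) (\<psi> ` (D \<inter> U)) (f \<circ> inv_into (D \<inter> U) \<psi>)"
      using smooth_funsD[OF U(3) cU] by (simp add: open_submfd_def)
    moreover have "\<forall>v\<in>\<psi> ` (D \<inter> U). (f \<circ> inv_into D \<psi>) v = (f \<circ> inv_into (D \<inter> U) \<psi>) v"
      using chart(2) by (auto simp: inv_into_f_f inj_on_Int)
    moreover have "w \<in> \<psi> ` (D \<inter> U)"
      using p U(2) by blast
    ultimately show "\<exists>V g. openin (Euclidean_space (mfd_dim M)) V \<and> w \<in> V \<and> smooth_on (mfd_dim M) V g \<and>
        (\<forall>v\<in>V. (f \<circ> inv_into D \<psi>) v = g v)"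
      using openin_chart_image_Int[OF M c U(1)] by (intro exI conjI)
  qed
qed

text \<open>In coordinates the composite is the chart expression of \<open>g\<close> after that of
  \<open>h\<close>, so the chain rule applies. As \<open>h\<close> may spread one chart domain over
  several charts of \<open>N\<close>, this works only locally.\<close>

lemma smooth_funs_pullback:
  assumes M: "locally_parametrized M" and N: "locally_parametrized N"
    and h: "mfd_smooth_map M N h" and g: "g \<in> smooth_funs N"
  shows "(\<lambda>p. g (h p)) \<in> smooth_funs M"
proof (rule smooth_funsI)
  fix D \<psi> assume c: "(D, \<psi>) \<in> mfd_charts M"
  note chart = locally_parametrized_chart[OF M c]
  have hcont: "continuous_map (mfd_top M) (mfd_top N) h"
    using h by (simp add: mfd_smooth_map_def)
  show "smooth_on (mfd_dim M) (\<psi> ` D) ((\<lambda>p. g (h p)) \<circ> inv_into D \<psi>)"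
  proof (rule smooth_on_local[OF chart(3)])
    fix w assume "w \<in> \<psi> ` D"
    then obtain p where p: "p \<in> D" "w = \<psi> p" by blast
    then have "h p \<in> mfd_points N"
      using openin_subset[OF chart(1)] continuous_map_image_subset_topspace[OF hcont] by blast
    then obtain E \<eta> where e: "(E, \<eta>) \<in> mfd_charts N" "h p \<in> E"
      using locally_parametrized_cover[OF N] by metis
    note chartE = locally_parametrized_chart[OF N e(1)]
    \<comment> \<open>Continuity of \<open>h\<close>, a part of \<open>mfd_smooth_map\<close>, makes
      this set open and hence the coordinate domain of the composite open.\<close>
    define P where "P = {p \<in> mfd_points M. h p \<in> E}"
    have P: "openin (mfd_top M) P"
      unfolding P_def by (rule openin_continuous_map_preimage[OF hcont chartE(1)])
    have DP: "D \<inter> P = {p \<in> D. h p \<in> E}"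
      using openin_subset[OF chart(1)] by (auto simp: P_def)
    let ?F = "\<eta> \<circ> h \<circ> inv_into D \<psi>"
    have F: "\<forall>j<mfd_dim N. smooth_on (mfd_dim M) (\<psi> ` (D \<inter> P)) (\<lambda>u. ?F u j)"
      using h c e(1) unfolding DP mfd_smooth_map_def smooth_map_on_def by blast
    have V: "openin (Euclidean_space (mfd_dim M)) (\<psi> ` (D \<inter> P))"
      by (rule openin_chart_image_Int[OF M c P])
    have FE: "?F u \<in> \<eta> ` E" "g (h (inv_into D \<psi> u)) = (g \<circ> inv_into E \<eta>) (?F u)"
      if "u \<in> \<psi> ` (D \<inter> P)" for u
      using that chart(2) chartE(2) by (auto simp: DP inv_into_f_f)
    have "smooth_on (mfd_dim M) (\<psi> ` (D \<inter> P)) (\<lambda>u. (g \<circ> inv_into E \<eta>) (?F u))"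
      using F FE(1) by (intro smooth_on_compose[OF V chartE(3) smooth_funsD[OF g e(1)]]) auto
    moreover have "\<forall>v\<in>\<psi> ` (D \<inter> P). ((\<lambda>p. g (h p)) \<circ> inv_into D \<psi>) v = (g \<circ> inv_into E \<eta>) (?F v)"
      using FE(2) by simp
    moreover have "w \<in> \<psi> ` (D \<inter> P)"
      using p e(2) DP by blast
    ultimately show "\<exists>V f. openin (Euclidean_space (mfd_dim M)) V \<and> w \<in> V \<and> smooth_on (mfd_dim M) V f \<and>
        (\<forall>v\<in>V. ((\<lambda>p. g (h p)) \<circ> inv_into D \<psi>) v = f v)"
      using V by (intro exI conjI)
  qed
qed

section \<open>Products\<close>

text \<open>Padding with zeros keeps the value in \<open>Euclidean_space m\<close>, whose points
  vanish from index \<open>m\<close> on. Together with \<open>final_coords\<close> this splits a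
  point into the coordinates of two factors.\<close>

definition init_coords :: "nat \<Rightarrow> (nat \<Rightarrow> real) \<Rightarrow> nat \<Rightarrow> real" where
  "init_coords m w = (\<lambda>i. if i < m then w i else 0)"

definition final_coords :: "nat \<Rightarrow> nat \<Rightarrow> (nat \<Rightarrow> real) \<Rightarrow> nat \<Rightarrow> real" where
  "final_coords m n w = (\<lambda>i. if i < n then w (m + i) else 0)"

text \<open>The coordinate map inside \<open>prod_mfd\<close>, named so that facts about its image
  and inverse can be stated.\<close>

definition prod_chart ::
    "nat \<Rightarrow> ('a \<Rightarrow> nat \<Rightarrow> real) \<Rightarrow> ('b \<Rightarrow> nat \<Rightarrow> real) \<Rightarrow> 'a \<times> 'b \<Rightarrow> nat \<Rightarrow> real" where
  "prod_chart m \<psi> \<eta> = (\<lambda>(p, q) i. if i < m then \<psi> p i else \<eta> q (i - m))"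

lemma mfd_charts_prod_mfd:
  "mfd_charts (prod_mfd M N) =
     {(D \<times> E, prod_chart (mfd_dim M) \<psi> \<eta>) | D \<psi> E \<eta>. (D, \<psi>) \<in> mfd_charts M \<and> (E, \<eta>) \<in> mfd_charts N}"
  by (simp add: prod_mfd_def prod_chart_def)

lemma continuous_map_init_coords: "continuous_map (Euclidean_space k) (Euclidean_space m) (init_coords m)"
  unfolding init_coords_def continuous_map_componentwise_Euclidean_space
  by (simp add: continuous_map_Euclidean_coordinate)

lemma continuous_map_final_coords: "continuous_map (Euclidean_space k) (Euclidean_space n) (final_coords m n)"
  unfolding final_coords_def continuous_map_componentwise_Euclidean_space
  by (simp add: continuous_map_Euclidean_coordinate)

context
  fixes M :: "'a mfd" and N :: "'b mfd" and D \<psi> E \<eta>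
  assumes M: "locally_parametrized M" and N: "locally_parametrized N"
    and c: "(D, \<psi>) \<in> mfd_charts M" and e: "(E, \<eta>) \<in> mfd_charts N"
begin

text \<open>Chart values vanish beyond the dimension, so padding with zeros recovers them
  exactly.\<close>

private lemma coords_prod_chart:
  assumes "p \<in> D" "q \<in> E"
  shows "init_coords (mfd_dim M) (prod_chart (mfd_dim M) \<psi> \<eta> (p, q)) = \<psi> p"
    and "final_coords (mfd_dim M) (mfd_dim N) (prod_chart (mfd_dim M) \<psi> \<eta> (p, q)) = \<eta> q"
proof -
  have "\<psi> p \<in> topspace (Euclidean_space (mfd_dim M))" "\<eta> q \<in> topspace (Euclidean_space (mfd_dim N))"
    using assms openin_subset[OF locally_parametrized_chart(3)[OF M c]]
      openin_subset[OF locally_parametrized_chart(3)[OF N e]] by auto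
  then show "init_coords (mfd_dim M) (prod_chart (mfd_dim M) \<psi> \<eta> (p, q)) = \<psi> p"
    and "final_coords (mfd_dim M) (mfd_dim N) (prod_chart (mfd_dim M) \<psi> \<eta> (p, q)) = \<eta> q"
    by (auto simp: init_coords_def final_coords_def prod_chart_def topspace_Euclidean_space fun_eq_iff)
qed

lemma inj_on_prod_chart: "inj_on (prod_chart (mfd_dim M) \<psi> \<eta>) (D \<times> E)"
proof (rule inj_onI)
  fix x y assume "x \<in> D \<times> E" "y \<in> D \<times> E"
    and eq: "prod_chart (mfd_dim M) \<psi> \<eta> x = prod_chart (mfd_dim M) \<psi> \<eta> y"
  then obtain p q p' q' where xy: "x = (p, q)" "y = (p', q')" "p \<in> D" "q \<in> E" "p' \<in> D" "q' \<in> E"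
    by blast
  have "\<psi> p = \<psi> p'" "\<eta> q = \<eta> q'"
    using coords_prod_chart[OF xy(3,4)] coords_prod_chart[OF xy(5,6)] eq unfolding xy(1,2) by simp_all
  then show "x = y"
    using xy inj_onD[OF locally_parametrized_chart(2)[OF M c]]
      inj_onD[OF locally_parametrized_chart(2)[OF N e]] by blast
qed

lemma prod_chart_image:
  "prod_chart (mfd_dim M) \<psi> \<eta> ` (D \<times> E) =
     {w \<in> topspace (Euclidean_space (mfd_dim M + mfd_dim N)).
        init_coords (mfd_dim M) w \<in> \<psi> ` D \<and> final_coords (mfd_dim M) (mfd_dim N) w \<in> \<eta> ` E}"
    (is "?L = ?R")
proof
  show "?L \<subseteq> ?R"
  proof
    fix w assume "w \<in> ?L"
    then obtain p q where pq: "p \<in> D" "q \<in> E" "w = prod_chart (mfd_dim M) \<psi> \<eta> (p, q)"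
      by blast
    have "\<eta> q \<in> topspace (Euclidean_space (mfd_dim N))"
      using pq(2) openin_subset[OF locally_parametrized_chart(3)[OF N e]] by auto
    then have "w \<in> topspace (Euclidean_space (mfd_dim M + mfd_dim N))"
      by (auto simp: pq(3) prod_chart_def topspace_Euclidean_space)
    then show "w \<in> ?R"
      using coords_prod_chart[OF pq(1,2)] pq by simp
  qed
  show "?R \<subseteq> ?L"
  proof
    fix w assume w: "w \<in> ?R"
    then obtain p q where pq: "p \<in> D" "init_coords (mfd_dim M) w = \<psi> p"
      "q \<in> E" "final_coords (mfd_dim M) (mfd_dim N) w = \<eta> q"
      by blast
    have "prod_chart (mfd_dim M) \<psi> \<eta> (p, q) i = w i" for i
      using w pq(2,4)[symmetric]
      by (auto simp: prod_chart_def init_coords_def final_coords_def topspace_Euclidean_space)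
    then have "w = prod_chart (mfd_dim M) \<psi> \<eta> (p, q)"
      by auto
    then show "w \<in> ?L"
      using pq(1,3) by blast
  qed
qed

lemma inv_into_prod_chart:
  assumes "w \<in> prod_chart (mfd_dim M) \<psi> \<eta> ` (D \<times> E)"
  shows "inv_into (D \<times> E) (prod_chart (mfd_dim M) \<psi> \<eta>) w =
    (inv_into D \<psi> (init_coords (mfd_dim M) w), inv_into E \<eta> (final_coords (mfd_dim M) (mfd_dim N) w))"
proof -
  obtain p q where pq: "p \<in> D" "q \<in> E" "w = prod_chart (mfd_dim M) \<psi> \<eta> (p, q)"
    using assms by blast
  show ?thesis
    unfolding pq(3) coords_prod_chart[OF pq(1,2)]
    using pq(1,2) inj_on_prod_chart locally_parametrized_chart(2)[OF M c] locally_parametrized_chart(2)[OF N e]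
    by (simp add: inv_into_f_f)
qed

text \<open>The image is the common preimage of two open sets under the continuous coordinate
  projections.\<close>

lemma openin_prod_chart_image:
  "openin (Euclidean_space (mfd_dim M + mfd_dim N)) (prod_chart (mfd_dim M) \<psi> \<eta> ` (D \<times> E))"
proof -
  have "openin (Euclidean_space (mfd_dim M + mfd_dim N))
     ({w \<in> topspace (Euclidean_space (mfd_dim M + mfd_dim N)). init_coords (mfd_dim M) w \<in> \<psi> ` D} \<inter>
      {w \<in> topspace (Euclidean_space (mfd_dim M + mfd_dim N)). final_coords (mfd_dim M) (mfd_dim N) w \<in> \<eta> ` E})"
    by (intro openin_Int openin_continuous_map_preimage[OF continuous_map_init_coords]
        openin_continuous_map_preimage[OF continuous_map_final_coords]
        locally_parametrized_chart(3)[OF M c] locally_parametrized_chart(3)[OF N e])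
  moreover have "prod_chart (mfd_dim M) \<psi> \<eta> ` (D \<times> E) =
     {w \<in> topspace (Euclidean_space (mfd_dim M + mfd_dim N)). init_coords (mfd_dim M) w \<in> \<psi> ` D} \<inter>
      {w \<in> topspace (Euclidean_space (mfd_dim M + mfd_dim N)). final_coords (mfd_dim M) (mfd_dim N) w \<in> \<eta> ` E}"
    unfolding prod_chart_image by blast
  ultimately show ?thesis
    by simp
qed

lemma continuous_map_inv_into_prod_chart:
  "continuous_map
     (subtopology (Euclidean_space (mfd_dim M + mfd_dim N)) (prod_chart (mfd_dim M) \<psi> \<eta> ` (D \<times> E)))
     (prod_topology (mfd_top M) (mfd_top N)) (inv_into (D \<times> E) (prod_chart (mfd_dim M) \<psi> \<eta>))"
proof -
  let ?W = "prod_chart (mfd_dim M) \<psi> \<eta> ` (D \<times> E)"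
  let ?S = "subtopology (Euclidean_space (mfd_dim M + mfd_dim N)) ?W"
  have W: "topspace ?S = ?W"
    by (rule topspace_subtopology_subset[OF openin_subset[OF openin_prod_chart_image]])
  have "continuous_map ?S (subtopology (Euclidean_space (mfd_dim M)) (\<psi> ` D)) (init_coords (mfd_dim M))"
    using continuous_map_from_subtopology[OF continuous_map_init_coords] W
    by (auto simp: continuous_map_in_subtopology prod_chart_image)
  moreover have "continuous_map ?S (subtopology (Euclidean_space (mfd_dim N)) (\<eta> ` E))
      (final_coords (mfd_dim M) (mfd_dim N))"
    using continuous_map_from_subtopology[OF continuous_map_final_coords] W
    by (auto simp: continuous_map_in_subtopology prod_chart_image)
  ultimately have "continuous_map ?S (prod_topology (mfd_top M) (mfd_top N))
      (\<lambda>w. (inv_into D \<psi> (init_coords (mfd_dim M) w), inv_into E \<eta> (final_coords (mfd_dim M) (mfd_dim N) w)))"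
    using continuous_map_compose[OF _ locally_parametrized_chart(4)[OF M c]]
      continuous_map_compose[OF _ locally_parametrized_chart(4)[OF N e]]
    by (intro continuous_map_paired[THEN iffD2] conjI) (simp_all add: o_def)
  then show ?thesis
    using inv_into_prod_chart W by (auto intro: continuous_map_eq)
qed

end

lemma locally_parametrized_prod_mfd:
  assumes M: "locally_parametrized M" and N: "locally_parametrized N"
  shows "locally_parametrized (prod_mfd M N)"
proof (rule locally_parametrizedI)
  fix x assume "x \<in> mfd_points (prod_mfd M N)"
  then obtain p q where x: "x = (p, q)" "p \<in> mfd_points M" "q \<in> mfd_points N"
    by (auto simp: prod_mfd_def)
  obtain D \<psi> where D: "(D, \<psi>) \<in> mfd_charts M" "p \<in> D"
    using locally_parametrized_cover[OF M x(2)] .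
  obtain E \<eta> where E: "(E, \<eta>) \<in> mfd_charts N" "q \<in> E"
    using locally_parametrized_cover[OF N x(3)] .
  show "\<exists>D \<psi>. (D, \<psi>) \<in> mfd_charts (prod_mfd M N) \<and> x \<in> D"
    unfolding mfd_charts_prod_mfd x(1) using D E by blast
next
  fix DE \<kappa> assume "(DE, \<kappa>) \<in> mfd_charts (prod_mfd M N)"
  then obtain D \<psi> E \<eta> where c: "(D, \<psi>) \<in> mfd_charts M" "(E, \<eta>) \<in> mfd_charts N"
    and DE: "DE = D \<times> E" "\<kappa> = prod_chart (mfd_dim M) \<psi> \<eta>"
    unfolding mfd_charts_prod_mfd by blast
  have dim: "mfd_dim (prod_mfd M N) = mfd_dim M + mfd_dim N"
    and top: "mfd_top (prod_mfd M N) = prod_topology (mfd_top M) (mfd_top N)"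
    by (simp_all add: prod_mfd_def)
  show "openin (mfd_top (prod_mfd M N)) DE"
    unfolding top DE using locally_parametrized_chart(1)[OF M c(1)] locally_parametrized_chart(1)[OF N c(2)]
    by (simp add: openin_prod_Times_iff)
  show "inj_on \<kappa> DE"
    unfolding DE by (rule inj_on_prod_chart[OF M N c])
  show "openin (Euclidean_space (mfd_dim (prod_mfd M N))) (\<kappa> ` DE)"
    unfolding DE dim by (rule openin_prod_chart_image[OF M N c])
  show "continuous_map (subtopology (Euclidean_space (mfd_dim (prod_mfd M N))) (\<kappa> ` DE))
      (mfd_top (prod_mfd M N)) (inv_into DE \<kappa>)"
    unfolding DE dim top by (rule continuous_map_inv_into_prod_chart[OF M N c])
qed

text \<open>In a product chart, \<open>G\<close> applied to functions on the factors becomes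
  \<open>G\<close> after a map whose components are chart expressions of these functions, so the
  chain rule applies. \<open>M\<close> and \<open>N\<close> are merely subspaces of
  \<open>T1\<close> and \<open>T2\<close>, which admits strata that are not open; the lemma serves
  both for link times interval and for ball times cone.\<close>

lemma prod_smooth_subset_smooth_funs:
  assumes M: "locally_parametrized M" and N: "locally_parametrized N"
    and T1: "mfd_top M = subtopology T1 (mfd_points M)" and T2: "mfd_top N = subtopology T2 (mfd_points N)"
    and C1: "C1 \<subseteq> smooth_funs M" and C2: "C2 \<subseteq> smooth_funs N"
  shows "prod_smooth T1 C1 T2 C2 \<subseteq> smooth_funs (prod_mfd M N)"
proof (intro subsetI smooth_funsI)
  fix g DE \<kappa> assume g: "g \<in> prod_smooth T1 C1 T2 C2" and c: "(DE, \<kappa>) \<in> mfd_charts (prod_mfd M N)"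
  note MN = locally_parametrized_prod_mfd[OF M N]
  note chart = locally_parametrized_chart[OF MN c]
  obtain D \<psi> E \<eta> where cD: "(D, \<psi>) \<in> mfd_charts M" and cE: "(E, \<eta>) \<in> mfd_charts N"
    and DE: "DE = D \<times> E" "\<kappa> = prod_chart (mfd_dim M) \<psi> \<eta>"
    using c unfolding mfd_charts_prod_mfd by blast
  note chartD = locally_parametrized_chart[OF M cD] and chartE = locally_parametrized_chart[OF N cE]
  have dim: "mfd_dim (prod_mfd M N) = mfd_dim M + mfd_dim N"
    and top: "mfd_top (prod_mfd M N) = prod_topology (mfd_top M) (mfd_top N)"
    by (simp_all add: prod_mfd_def)
  have top': "mfd_top (prod_mfd M N) = subtopology (prod_topology T1 T2) (mfd_points M \<times> mfd_points N)"
    unfolding top using T1 T2 by (metis prod_topology_subtopology(1) prod_topology_subtopology(2)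
        subtopology_Times)
  show "smooth_on (mfd_dim (prod_mfd M N)) (\<kappa> ` DE) (g \<circ> inv_into DE \<kappa>)"
  proof (rule smooth_on_local[OF chart(3)])
    fix w assume w: "w \<in> \<kappa> ` DE"
    then have invw: "inv_into DE \<kappa> w \<in> mfd_points (prod_mfd M N)"
      using inv_into_into[of w \<kappa> DE] openin_subset[OF chart(1)] by auto
    then have "inv_into DE \<kappa> w \<in> topspace (prod_topology T1 T2)"
      unfolding top' by simp
    then obtain V n k G fs hs where V: "openin (prod_topology T1 T2) V" "inv_into DE \<kappa> w \<in> V"
      and G: "smooth_on (n + k) (topspace (Euclidean_space (n + k))) G"
      and fs: "\<forall>i<n. fs i \<in> C1" and hs: "\<forall>j<k. hs j \<in> C2"
      and gV: "\<forall>(a, b)\<in>V. g (a, b) =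
             G (\<lambda>i. if i < n then fs i a else if i < n + k then hs (i - n) b else 0)"
      using g unfolding prod_smooth_def by blast
    \<comment> \<open>\<open>V\<close> lives in the ambient product; its trace is open in the
      product manifold, which carries the subspace topology.\<close>
    define O' where "O' = V \<inter> (mfd_points M \<times> mfd_points N)"
    have O': "openin (mfd_top (prod_mfd M N)) O'"
      unfolding O'_def top' using V(1) by (auto simp: openin_subtopology)
    define W where "W = {w \<in> \<kappa> ` DE. inv_into DE \<kappa> w \<in> O'}"
    have W: "openin (Euclidean_space (mfd_dim M + mfd_dim N)) W"
      using openin_chart_image[OF MN c O'] unfolding W_def dim .
    have inv: "inv_into DE \<kappa> u = (inv_into D \<psi> (init_coords (mfd_dim M) u),
        inv_into E \<eta> (final_coords (mfd_dim M) (mfd_dim N) u))" if "u \<in> W" for u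
      using that inv_into_prod_chart[OF M N cD cE, of u] unfolding W_def DE by blast
    have WD: "init_coords (mfd_dim M) u \<in> \<psi> ` D" "final_coords (mfd_dim M) (mfd_dim N) u \<in> \<eta> ` E"
      if "u \<in> W" for u
      using that prod_chart_image[OF M N cD cE] unfolding W_def DE by auto
    let ?F = "\<lambda>u i. if i < n then fs i (inv_into D \<psi> (init_coords (mfd_dim M) u))
      else if i < n + k then hs (i - n) (inv_into E \<eta> (final_coords (mfd_dim M) (mfd_dim N) u)) else 0"
    have eq: "(g \<circ> inv_into DE \<kappa>) u = G (?F u)" if u: "u \<in> W" for u
    proof -
      have "inv_into DE \<kappa> u \<in> V"
        using u by (simp add: W_def O'_def)
      then show ?thesis
        using gV unfolding comp_apply inv[OF u] by auto
    qed
    have "smooth_on (mfd_dim M + mfd_dim N) W (\<lambda>u. (f \<circ> inv_into D \<psi>) (init_coords (mfd_dim M) u))"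
      if "f \<in> C1" for f
    proof (rule smooth_on_compose[OF W chartD(3) smooth_funsD[OF _ cD] _ WD(1)])
      show "f \<in> smooth_funs M"
        using that C1 by blast
      show "smooth_on (mfd_dim M + mfd_dim N) W (\<lambda>u. init_coords (mfd_dim M) u j)" if "j < mfd_dim M" for j
        using that smooth_on_coordinate[OF W] by (simp add: init_coords_def)
    qed
    moreover have "smooth_on (mfd_dim M + mfd_dim N) W
        (\<lambda>u. (f \<circ> inv_into E \<eta>) (final_coords (mfd_dim M) (mfd_dim N) u))" if "f \<in> C2" for f
    proof (rule smooth_on_compose[OF W chartE(3) smooth_funsD[OF _ cE] _ WD(2)])
      show "f \<in> smooth_funs N"
        using that C2 by blast
      show "smooth_on (mfd_dim M + mfd_dim N) W (\<lambda>u. final_coords (mfd_dim M) (mfd_dim N) u j)"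
        if "j < mfd_dim N" for j
        using that smooth_on_coordinate[OF W] by (simp add: final_coords_def)
    qed
    ultimately have F: "smooth_on (mfd_dim M + mfd_dim N) W (\<lambda>u. ?F u j)" if "j < n + k" for j
      using that fs hs by (cases "j < n") simp_all
    have "smooth_on (mfd_dim M + mfd_dim N) W (\<lambda>u. G (?F u))"
    proof (rule smooth_on_compose[OF W _ G F])
      \<comment> \<open>The final \<open>else 0\<close> is what places these tuples in
        \<open>Euclidean_space (n + k)\<close>.\<close>
      show "?F u \<in> topspace (Euclidean_space (n + k))" for u
        by (simp add: topspace_Euclidean_space)
    qed simp_all
    moreover have "w \<in> W"
      using w V(2) invw unfolding W_def O'_def top by simp
    ultimately show "\<exists>V f. openin (Euclidean_space (mfd_dim (prod_mfd M N))) V \<and> w \<in> V \<and>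
        smooth_on (mfd_dim (prod_mfd M N)) V f \<and> (\<forall>v\<in>V. (g \<circ> inv_into DE \<kappa>) v = f v)"
      unfolding dim using W eq by (intro exI[of _ W] exI[of _ "\<lambda>u. G (?F u)"]) simp
  qed
qed

section \<open>Cones\<close>

lemma cone_class_in_cone_points: "z \<in> topspace T \<Longrightarrow> 0 \<le> t \<Longrightarrow> cone_class T z t \<in> cone_points T"
  unfolding cone_points_def by blast

text \<open>A class of positive height is a singleton of that height, whereas the apex has only
  elements of height 0 and may even be empty; so the two never coincide.\<close>

lemma cone_class_eqD:
  assumes "0 < t'" "cone_class T z t = cone_class T z' t'"
  shows "z = z' \<and> t = t'"
proof -
  have eq: "cone_class T z t = {(z', t')}"
    using assms by (simp add: cone_class_def)
  then have "(z', t') \<in> cone_class T z t"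
    by simp
  then have "t \<noteq> 0"
    using assms(1) by (auto simp: cone_class_def cone_apex_def)
  then show ?thesis
    using eq by (simp add: cone_class_def)
qed

lemma topspace_cone_top: "topspace (cone_top T) = cone_points T"
proof -
  have eq: "{(z, t). z \<in> topspace T \<and> 0 \<le> t \<and> cone_class T z t \<in> cone_points T} =
      topspace (prod_topology T (top_of_set {0..}))"
    by (auto simp: cone_points_def)
  have "cone_open T (cone_points T)"
    unfolding cone_open_def eq by (simp only: openin_topspace subset_refl simp_thms)
  moreover have "W \<subseteq> cone_points T" if "cone_open T W" for W
    using that by (simp add: cone_open_def)
  ultimately show ?thesis
    unfolding topspace_def openin_cone_top by blast
qed

lemma topspace_open_cone_top:
  "\<epsilon> > 0 \<Longrightarrow> topspace (open_cone_top T \<epsilon>) =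
     insert (cone_apex T) {cone_class T z t | z t. z \<in> topspace T \<and> 0 \<le> t \<and> t < \<epsilon>}"
  unfolding open_cone_top_def topspace_subtopology topspace_cone_top
  by (auto simp: cone_points_def)

abbreviation cone_map :: "'a topology \<Rightarrow> 'a \<times> real \<Rightarrow> ('a \<times> real) set" where
  "cone_map T \<equiv> \<lambda>(z, t). cone_class T z t"

text \<open>The cone topology is defined through heights in \<open>{0..}\<close>; this connects it
  with the open interval used for the strata.\<close>

lemma prod_topology_unit_interval:
  "prod_topology T (top_of_set {0<..<1::real}) =
   subtopology (prod_topology T (top_of_set {0..})) (topspace T \<times> {0<..<1})"
proof -
  have "top_of_set {0<..<1::real} = subtopology (top_of_set {0..}) {0<..<1}"
    by (auto simp: subtopology_subtopology intro: arg_cong[where f = "subtopology euclidean"])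
  then show ?thesis
    by (simp add: subtopology_Times)
qed

lemma inj_on_cone_map: "inj_on (cone_map T) (S \<times> {0<..<1})"
  by (auto simp: inj_on_def cone_class_def)

text \<open>A set is open in the cone when its preimage in the cylinder is open; it remains to cut
  that preimage down to heights between 0 and 1.\<close>

lemma continuous_map_cone_map:
  "continuous_map (prod_topology T (top_of_set {0<..<1})) (open_cone_top T 1) (cone_map T)"
proof -
  let ?P = "prod_topology T (top_of_set {0::real..})"
  have "openin (prod_topology T (top_of_set {0<..<1}))
      {x \<in> topspace (prod_topology T (top_of_set {0<..<1})). cone_map T x \<in> W}" if "cone_open T W" for W
  proof -
    have "openin ?P {(z, t). z \<in> topspace T \<and> 0 \<le> t \<and> cone_class T z t \<in> W}"
      using that by (simp add: cone_open_def)
    then have "openin (subtopology ?P (topspace T \<times> {0<..<1}))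
        ({(z, t). z \<in> topspace T \<and> 0 \<le> t \<and> cone_class T z t \<in> W} \<inter> (topspace T \<times> {0<..<1}))"
      unfolding openin_subtopology by blast
    moreover have "{(z, t). z \<in> topspace T \<and> 0 \<le> t \<and> cone_class T z t \<in> W} \<inter> (topspace T \<times> {0<..<1}) =
        {x \<in> topspace (prod_topology T (top_of_set {0<..<1})). cone_map T x \<in> W}"
      by auto
    ultimately show ?thesis
      unfolding prod_topology_unit_interval[symmetric] by simp
  qed
  then have "continuous_map (prod_topology T (top_of_set {0<..<1})) (cone_top T) (cone_map T)"
    unfolding continuous_map_def openin_cone_top topspace_cone_top
    by (auto intro: cone_class_in_cone_points)
  then show ?thesis
    unfolding open_cone_top_def by (force simp: continuous_map_in_subtopology)
qed

text \<open>At positive heights the quotient map identifies nothing, so \<open>O'\<close> is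
  saturated and its image has the open set \<open>O'\<close> as full preimage.\<close>

lemma openin_cone_map_image:
  assumes O': "openin (prod_topology T (top_of_set {0<..<1})) O'"
  shows "openin (open_cone_top T 1) (cone_map T ` O')"
proof -
  let ?P = "prod_topology T (top_of_set {0::real..})"
  have sub: "O' \<subseteq> topspace T \<times> {0<..<1}"
    using openin_subset[OF O'] by simp
  have in01: "z \<in> topspace T" "0 < t" "t < 1" if "(z, t) \<in> O'" for z t
    using subsetD[OF sub that] by auto
  have "openin (top_of_set {0::real..}) {0<..<1}"
    by (rule open_subset) auto
  then have "openin ?P (topspace T \<times> {0<..<1})"
    by (simp add: openin_prod_Times_iff)
  then have "openin ?P O'"
    using O' unfolding prod_topology_unit_interval by (rule openin_trans_full[rotated])
  moreover have "{(z, t). z \<in> topspace T \<and> 0 \<le> t \<and> cone_class T z t \<in> cone_map T ` O'} = O'"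
  proof (intro subset_antisym subsetI)
    fix x assume "x \<in> {(z, t). z \<in> topspace T \<and> 0 \<le> t \<and> cone_class T z t \<in> cone_map T ` O'}"
    then obtain z t z' t' where x: "x = (z, t)" and z': "(z', t') \<in> O'" "cone_class T z t = cone_class T z' t'"
      by auto
    then have "0 < t'"
      using sub by auto
    then show "x \<in> O'"
      using cone_class_eqD[OF _ z'(2)] x z'(1) by simp
  next
    fix x assume "x \<in> O'"
    then show "x \<in> {(z, t). z \<in> topspace T \<and> 0 \<le> t \<and> cone_class T z t \<in> cone_map T ` O'}"
      using sub by (cases x) (auto intro!: image_eqI[of _ _ x])
  qed
  moreover have "cone_map T ` O' \<subseteq> cone_points T"
    by (auto intro!: cone_class_in_cone_points dest: in01)
  ultimately have "openin (cone_top T) (cone_map T ` O')"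
    unfolding openin_cone_top cone_open_def by simp
  moreover have "cone_map T ` O' \<subseteq> insert (cone_apex T) {cone_class T z t | z t. z \<in> topspace T \<and> 0 \<le> t \<and> t < 1}"
    using in01 by (fastforce intro: less_imp_le)
  ultimately show ?thesis
    unfolding open_cone_top_def openin_subtopology
    by (intro exI[of _ "cone_map T ` O'"] conjI Int_absorb2[symmetric])
qed

section \<open>Charts on the strata of the cone\<close>

lemma locally_parametrized_unit_interval: "locally_parametrized unit_interval_mfd"
proof (rule locally_parametrizedI)
  fix p assume "p \<in> mfd_points unit_interval_mfd"
  then show "\<exists>D \<psi>. (D, \<psi>) \<in> mfd_charts unit_interval_mfd \<and> p \<in> D"
    by (auto simp: unit_interval_mfd_def)
next
  let ?\<psi> = "\<lambda>t (i::nat). if i = 0 then t else (0::real)"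
  fix D \<psi> assume "(D, \<psi>) \<in> mfd_charts unit_interval_mfd"
  then have D: "D = {0<..<1}" and \<psi>: "\<psi> = ?\<psi>"
    by (auto simp: unit_interval_mfd_def)
  show "openin (mfd_top unit_interval_mfd) D"
    by (simp add: unit_interval_mfd_def D)
  show inj: "inj_on \<psi> D"
    unfolding \<psi> by (rule inj_on_inverseI[of _ "\<lambda>w. w 0"]) simp
  have im: "\<psi> ` D = {w \<in> topspace (Euclidean_space 1). w 0 \<in> {0<..<1}}" (is "_ = ?R")
  proof
    show "\<psi> ` D \<subseteq> ?R"
      by (auto simp: \<psi> D topspace_Euclidean_space)
    show "?R \<subseteq> \<psi> ` D"
    proof
      fix w assume w: "w \<in> ?R"
      then have "w = \<psi> (w 0)"
        by (auto simp: \<psi> topspace_Euclidean_space fun_eq_iff)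
      then show "w \<in> \<psi> ` D"
        using w D by blast
    qed
  qed
  have dim: "mfd_dim unit_interval_mfd = 1"
    by (simp add: unit_interval_mfd_def)
  show op: "openin (Euclidean_space (mfd_dim unit_interval_mfd)) (\<psi> ` D)"
    unfolding im dim by (rule openin_Euclidean_line) simp
  have W: "topspace (subtopology (Euclidean_space 1) (\<psi> ` D)) = \<psi> ` D"
    using topspace_subtopology_subset[OF openin_subset[OF op]] unfolding dim .
  have "continuous_map (subtopology (Euclidean_space 1) (\<psi> ` D)) (top_of_set {0<..<1}) (\<lambda>w. w 0)"
    using continuous_map_from_subtopology[OF continuous_map_Euclidean_coordinate] W
    by (auto simp: continuous_map_in_subtopology \<psi> D)
  moreover have "w 0 = inv_into D \<psi> w" if "w \<in> \<psi> ` D" for w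
    using that inj by (auto simp: inv_into_f_f) (simp add: \<psi>)
  ultimately show "continuous_map (subtopology (Euclidean_space (mfd_dim unit_interval_mfd)) (\<psi> ` D))
      (mfd_top unit_interval_mfd) (inv_into D \<psi>)"
    unfolding dim using W by (auto simp: unit_interval_mfd_def intro: continuous_map_eq)
qed

text \<open>Brings both kinds of strata into the form of subspace that
  \<open>prod_smooth_subset_smooth_funs\<close> expects.\<close>

lemma mfd_top_cone_stratum:
  "mfd_top (cone_stratum L k) =
     subtopology (open_cone_top (dec_top L) 1) (mfd_points (cone_stratum L k))"
proof -
  have "\<exists>S. mfd_top (cone_stratum L k) = subtopology (open_cone_top (dec_top L) 1) S"
    by (cases k) (auto simp: cone_stratum_def Let_def)
  then show ?thesis
    by (metis subtopology_restrict topspace_subtopology)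
qed

lemma locally_parametrized_cone_apex: "locally_parametrized (cone_stratum L None)"
proof (rule locally_parametrizedI)
  let ?a = "cone_apex (dec_top L)"
  have pts: "mfd_points (cone_stratum L None) = {?a}"
    by (simp add: cone_stratum_def topspace_open_cone_top)
  show "\<exists>D \<psi>. (D, \<psi>) \<in> mfd_charts (cone_stratum L None) \<and> p \<in> D"
    if "p \<in> mfd_points (cone_stratum L None)" for p
    using that unfolding pts by (simp add: cone_stratum_def)
  fix D \<psi> assume c: "(D, \<psi>) \<in> mfd_charts (cone_stratum L None)"
  then have D: "D = {?a}" and \<psi>: "\<psi> = (\<lambda>_ _. 0)"
    by (simp_all add: cone_stratum_def)
  show "openin (mfd_top (cone_stratum L None)) D"
    using openin_topspace[of "mfd_top (cone_stratum L None)"] unfolding pts D .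
  show "inj_on \<psi> D"
    by (simp add: D)
  have dim: "mfd_dim (cone_stratum L None) = 0"
    by (simp add: cone_stratum_def)
  have im: "\<psi> ` D = topspace (Euclidean_space 0)"
    by (auto simp: D \<psi> topspace_Euclidean_space)
  show "openin (Euclidean_space (mfd_dim (cone_stratum L None))) (\<psi> ` D)"
    unfolding dim im by simp
  have cont: "continuous_map (subtopology (Euclidean_space 0) (\<psi> ` D)) (mfd_top (cone_stratum L None)) (\<lambda>_. ?a)"
    using pts by simp
  have "inv_into D \<psi> w = ?a" if "w \<in> \<psi> ` D" for w
    using inv_into_into[OF that] D by simp
  then show "continuous_map (subtopology (Euclidean_space (mfd_dim (cone_stratum L None))) (\<psi> ` D))
      (mfd_top (cone_stratum L None)) (inv_into D \<psi>)"
    unfolding dim by (intro continuous_map_eq[OF cont]) simp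
qed

text \<open>\<open>Euclidean_space 0\<close> has a single point, so every function is constant in
  coordinates.\<close>

lemma smooth_funs_cone_apex: "f \<in> smooth_funs (cone_stratum L None)"
proof (rule smooth_funsI)
  fix D \<psi> assume c: "(D, \<psi>) \<in> mfd_charts (cone_stratum L None)"
  have dim: "mfd_dim (cone_stratum L None) = 0"
    by (simp add: cone_stratum_def)
  note op = locally_parametrized_chart(3)[OF locally_parametrized_cone_apex c]
  show "smooth_on (mfd_dim (cone_stratum L None)) (\<psi> ` D) (f \<circ> inv_into D \<psi>)"
  proof (rule smooth_on_cong[OF op smooth_on_const[OF op]])
    fix w assume "w \<in> \<psi> ` D"
    then have "w \<in> topspace (Euclidean_space 0)"
      using openin_subset[OF op] unfolding dim by (rule subsetD[rotated])
    then have "w = (\<lambda>_. 0)"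
      by (auto simp: topspace_Euclidean_space)
    then show "(f \<circ> inv_into D \<psi>) w = (f \<circ> inv_into D \<psi>) (\<lambda>_. 0)"
      by simp
  qed
qed

lemma cone_stratum_Some:
  "mfd_top (cone_stratum L (Some j)) = subtopology (open_cone_top (dec_top L) 1)
     (cone_map (dec_top L) ` mfd_points (prod_mfd (dec_stratum L j) unit_interval_mfd))"
  "mfd_dim (cone_stratum L (Some j)) = mfd_dim (prod_mfd (dec_stratum L j) unit_interval_mfd)"
  "mfd_charts (cone_stratum L (Some j)) =
     (\<lambda>(D, \<psi>). (cone_map (dec_top L) ` D, \<psi> \<circ> inv_into D (cone_map (dec_top L)))) `
       mfd_charts (prod_mfd (dec_stratum L j) unit_interval_mfd)"
  by (simp_all add: cone_stratum_def Let_def)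

context
  fixes L :: "('a, 'i) decomp" and j :: 'i and M :: "('a \<times> real) mfd"
  assumes Lj: "locally_parametrized (dec_stratum L j)"
    and top: "mfd_top (dec_stratum L j) = subtopology (dec_top L) (stratum_set L j)"
  defines "M \<equiv> prod_mfd (dec_stratum L j) unit_interval_mfd"
begin

private lemma M: "locally_parametrized M"
  unfolding M_def by (intro locally_parametrized_prod_mfd Lj locally_parametrized_unit_interval)

private lemma top_M:
  "mfd_top M = subtopology (prod_topology (dec_top L) (top_of_set {0<..<1})) (stratum_set L j \<times> {0<..<1})"
  using top unfolding M_def prod_mfd_def
  by (simp add: unit_interval_mfd_def subtopology_Times subtopology_subtopology)

private lemma points_M: "mfd_points M = stratum_set L j \<times> {0<..<1}"
  by (simp add: M_def prod_mfd_def unit_interval_mfd_def)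

text \<open>The chart on the cone is \<open>\<psi>\<close> after the inverse of the quotient map. It
  has the same image as \<open>\<psi>\<close>, and its inverse is the quotient map after that of
  \<open>\<psi>\<close>; hence a function on the cone stratum and its composite with the quotient
  map look the same in coordinates.\<close>

private lemma chart_cone:
  assumes c: "(D, \<psi>) \<in> mfd_charts M"
  shows "inj_on (cone_map (dec_top L)) D"
    and "(\<psi> \<circ> inv_into D (cone_map (dec_top L))) ` (cone_map (dec_top L) ` D) = \<psi> ` D"
    and "inj_on (\<psi> \<circ> inv_into D (cone_map (dec_top L))) (cone_map (dec_top L) ` D)"
    and "w \<in> \<psi> ` D \<Longrightarrow> inv_into (cone_map (dec_top L) ` D) (\<psi> \<circ> inv_into D (cone_map (dec_top L))) w =
           cone_map (dec_top L) (inv_into D \<psi> w)"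
proof -
  let ?h = "cone_map (dec_top L)"
  note chart = locally_parametrized_chart[OF M c]
  have "D \<subseteq> stratum_set L j \<times> {0<..<1}"
    using openin_subset[OF chart(1)] unfolding points_M .
  then show inj: "inj_on ?h D"
    using inj_on_cone_map inj_on_subset by blast
  have inv: "(\<psi> \<circ> inv_into D ?h) (?h x) = \<psi> x" if "x \<in> D" for x
    using that inj by (simp add: inv_into_f_f)
  then show "(\<psi> \<circ> inv_into D ?h) ` (?h ` D) = \<psi> ` D"
    unfolding image_image by (rule image_cong[OF refl])
  show inj': "inj_on (\<psi> \<circ> inv_into D ?h) (?h ` D)"
    using inv chart(2) by (auto simp: inj_on_def)
  show "inv_into (?h ` D) (\<psi> \<circ> inv_into D ?h) w = ?h (inv_into D \<psi> w)" if w: "w \<in> \<psi> ` D"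
  proof (rule inv_into_f_eq[OF inj'])
    have "inv_into D \<psi> w \<in> D"
      using w by (rule inv_into_into)
    then show "?h (inv_into D \<psi> w) \<in> ?h ` D"
      by blast
    show "(\<psi> \<circ> inv_into D ?h) (?h (inv_into D \<psi> w)) = w"
      using inv[OF \<open>inv_into D \<psi> w \<in> D\<close>] f_inv_into_f[OF w] by simp
  qed
qed

lemma locally_parametrized_cone_stratum: "locally_parametrized (cone_stratum L (Some j))"
proof (rule locally_parametrizedI)
  let ?h = "cone_map (dec_top L)"
  fix p assume "p \<in> mfd_points (cone_stratum L (Some j))"
  then have "p \<in> ?h ` mfd_points M"
    unfolding cone_stratum_Some M_def[symmetric] by simp
  then obtain x where x: "x \<in> mfd_points M" "p = ?h x" by blast
  obtain D \<psi> where "(D, \<psi>) \<in> mfd_charts M" "x \<in> D"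
    using locally_parametrized_cover[OF M x(1)] .
  then show "\<exists>D \<psi>. (D, \<psi>) \<in> mfd_charts (cone_stratum L (Some j)) \<and> p \<in> D"
    unfolding cone_stratum_Some M_def[symmetric] x(2) by force
next
  let ?h = "cone_map (dec_top L)"
  fix D' \<psi>' assume "(D', \<psi>') \<in> mfd_charts (cone_stratum L (Some j))"
  then obtain D \<psi> where c: "(D, \<psi>) \<in> mfd_charts M" and D': "D' = ?h ` D" "\<psi>' = \<psi> \<circ> inv_into D ?h"
    unfolding cone_stratum_Some M_def[symmetric] by auto
  note chart = locally_parametrized_chart[OF M c]
  obtain O' where O': "openin (prod_topology (dec_top L) (top_of_set {0<..<1})) O'"
    "D = O' \<inter> (stratum_set L j \<times> {0<..<1})"
    using chart(1) unfolding top_M openin_subtopology by blast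
  \<comment> \<open>Injectivity at positive heights lets the image commute with the intersection and
    exhibits the chart domain as the trace of an open subset of the cone.\<close>
  have "?h ` D = ?h ` O' \<inter> ?h ` mfd_points M"
    unfolding O'(2) points_M
    by (rule inj_on_image_Int[OF inj_on_cone_map[of _ UNIV]]) (use openin_subset[OF O'(1)] in auto)
  then show "openin (mfd_top (cone_stratum L (Some j))) D'"
    unfolding cone_stratum_Some M_def[symmetric] D' openin_subtopology
    using openin_cone_map_image[OF O'(1)] by blast
  show "inj_on \<psi>' D'"
    unfolding D' by (rule chart_cone(3)[OF c])
  have im: "\<psi>' ` D' = \<psi> ` D"
    unfolding D' by (rule chart_cone(2)[OF c])
  have dim: "mfd_dim (cone_stratum L (Some j)) = mfd_dim M"
    by (simp add: cone_stratum_Some M_def)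
  show "openin (Euclidean_space (mfd_dim (cone_stratum L (Some j)))) (\<psi>' ` D')"
    unfolding im dim by (rule chart(3))
  have "continuous_map (mfd_top M) (open_cone_top (dec_top L) 1) ?h"
    unfolding top_M by (rule continuous_map_from_subtopology[OF continuous_map_cone_map])
  then have "continuous_map (mfd_top M) (mfd_top (cone_stratum L (Some j))) ?h"
    unfolding cone_stratum_Some M_def[symmetric] by (auto simp: continuous_map_in_subtopology)
  with chart(4) have cont: "continuous_map (subtopology (Euclidean_space (mfd_dim M)) (\<psi> ` D))
      (mfd_top (cone_stratum L (Some j))) (?h \<circ> inv_into D \<psi>)"
    by (rule continuous_map_compose)
  have "(?h \<circ> inv_into D \<psi>) w = inv_into D' \<psi>' w" if "w \<in> \<psi> ` D" for w
    using chart_cone(4)[OF c that] by (simp add: D')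
  then show "continuous_map (subtopology (Euclidean_space (mfd_dim (cone_stratum L (Some j)))) (\<psi>' ` D'))
      (mfd_top (cone_stratum L (Some j))) (inv_into D' \<psi>')"
    unfolding im dim by (intro continuous_map_eq[OF cont]) simp
qed

lemma smooth_funs_cone_stratum:
  assumes g: "(\<lambda>(z, t). g (cone_class (dec_top L) z t)) \<in> smooth_funs M"
  shows "g \<in> smooth_funs (cone_stratum L (Some j))"
proof (rule smooth_funsI)
  let ?h = "cone_map (dec_top L)"
  fix D' \<psi>' assume "(D', \<psi>') \<in> mfd_charts (cone_stratum L (Some j))"
  then obtain D \<psi> where c: "(D, \<psi>) \<in> mfd_charts M" and D': "D' = ?h ` D" "\<psi>' = \<psi> \<circ> inv_into D ?h"
    unfolding cone_stratum_Some M_def[symmetric] by auto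
  have im: "\<psi>' ` D' = \<psi> ` D"
    unfolding D' by (rule chart_cone(2)[OF c])
  have dim: "mfd_dim (cone_stratum L (Some j)) = mfd_dim M"
    by (simp add: cone_stratum_Some M_def)
  show "smooth_on (mfd_dim (cone_stratum L (Some j))) (\<psi>' ` D') (g \<circ> inv_into D' \<psi>')"
    unfolding im dim
  proof (rule smooth_on_cong[OF locally_parametrized_chart(3)[OF M c] smooth_funsD[OF g c]])
    show "(g \<circ> inv_into D' \<psi>') w = ((\<lambda>(z, t). g (cone_class (dec_top L) z t)) \<circ> inv_into D \<psi>) w"
      if "w \<in> \<psi> ` D" for w
      using chart_cone(4)[OF c that] by (simp add: D' split_beta)
  qed
qed

end

section \<open>From the link to the strata of the cone\<close>

lemma decomposed_spaceD:
  assumes "decomposed_space X" "i \<in> dec_index X"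
  shows "locally_parametrized (dec_stratum X i)"
    and "mfd_top (dec_stratum X i) = subtopology (dec_top X) (stratum_set X i)"
  using assms smooth_manifold_locally_parametrized unfolding decomposed_space_def by blast+

lemma cone_stratum_smooth:
  assumes L: "decomposed_space L" and A: "cone_smooth_structure L CL A"
    and CL: "\<forall>j\<in>dec_index L. CL \<subseteq> smooth_funs (dec_stratum L j)"
    and k: "k \<in> dec_index (cone_decomp L)"
  shows "locally_parametrized (cone_stratum L k)" "A \<subseteq> smooth_funs (cone_stratum L k)"
proof -
  have "locally_parametrized (cone_stratum L k) \<and> A \<subseteq> smooth_funs (cone_stratum L k)"
  proof (cases k)
    case None
    then show ?thesis
      using locally_parametrized_cone_apex smooth_funs_cone_apex by blast
  next
    case (Some j)
    then have j: "j \<in> dec_index L"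
      using k by (auto simp: cone_decomp_def)
    note Lj = decomposed_spaceD[OF L j]
    have "g \<in> smooth_funs (cone_stratum L (Some j))" if "g \<in> A" for g
    proof (rule smooth_funs_cone_stratum[OF Lj])
      have "(\<lambda>(z, t). g (cone_class (dec_top L) z t))
        \<in> prod_smooth (dec_top L) CL (mfd_top unit_interval_mfd) (smooth_funs unit_interval_mfd)"
        using A that unfolding cone_smooth_structure_def by blast
      moreover have "prod_smooth (dec_top L) CL (mfd_top unit_interval_mfd) (smooth_funs unit_interval_mfd)
          \<subseteq> smooth_funs (prod_mfd (dec_stratum L j) unit_interval_mfd)"
        by (rule prod_smooth_subset_smooth_funs[OF Lj(1) locally_parametrized_unit_interval Lj(2)])
          (use CL j in auto)
      ultimately show "(\<lambda>(z, t). g (cone_class (dec_top L) z t))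
          \<in> smooth_funs (prod_mfd (dec_stratum L j) unit_interval_mfd)"
        by blast
    qed
    then show ?thesis
      using locally_parametrized_cone_stratum[OF Lj] Some by blast
  qed
  then show "locally_parametrized (cone_stratum L k)" "A \<subseteq> smooth_funs (cone_stratum L k)"
    by auto
qed

section \<open>Smooth structures\<close>

text \<open>The premise \<open>decomposed_space X\<close> is kept inside the induction and is
  recovered for a link from \<open>stratified_space L\<close>. The index \<open>i\<close> is
  generalized because all strata of the link are needed.\<close>

lemma smooth_structure_restrict_stratum:
  "smooth_structure X C \<Longrightarrow> decomposed_space X \<Longrightarrow> i \<in> dec_index X \<Longrightarrow> C \<subseteq> smooth_funs (dec_stratum X i)"
proof (induction arbitrary: i rule: smooth_structure.induct)
  case (1 X C)
  note X = decomposed_spaceD[OF "1.prems"]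
  show ?case
  proof
    fix f assume f: "f \<in> C"
    show "f \<in> smooth_funs (dec_stratum X i)"
    proof (rule smooth_funs_local[OF X(1)])
      fix x assume x: "x \<in> stratum_set X i"
      obtain U B L \<phi> CL A where L: "stratified_space L" and triv: "local_triv X i x U B L \<phi>"
        and IH: "decomposed_space L \<longrightarrow>
          (\<forall>j. j \<in> dec_index L \<longrightarrow> CL \<subseteq> smooth_funs (dec_stratum L j))"
        and A: "cone_smooth_structure L CL A"
        and sec: "sheaf_sections (dec_top X) C U =
          {f. \<exists>g \<in> prod_smooth (mfd_top (open_submfd (dec_stratum X i) B))
                     (smooth_funs (open_submfd (dec_stratum X i) B)) (open_cone_top (dec_top L) 1) A.
                \<forall>p\<in>U. f p = g (\<phi> p)}"
        using bspec[OF bspec[OF "1.IH" "1.prems"(2)] x] by (elim exE conjE) (rule that)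
      have dL: "decomposed_space L"
        using L by (cases rule: stratified_space.cases)
      have U: "openin (dec_top X) U" "x \<in> U" and B: "openin (mfd_top (dec_stratum X i)) B"
        and iso: "decomp_iso (restrict_decomp X U)
          (prod_decomp (open_submfd (dec_stratum X i) B) (cone_decomp L)) \<phi>"
        using triv unfolding local_triv_def open_ball_around_def by blast+
      let ?S = "open_submfd (dec_stratum X i) (stratum_set X i \<inter> U)"
      let ?B = "open_submfd (dec_stratum X i) B"
      have i: "i \<in> dec_index (restrict_decomp X U)"
        and Si: "dec_stratum (restrict_decomp X U) i = ?S"
        using "1.prems"(2) x U(2) by (auto simp: restrict_decomp_def Let_def)
      have prod: "dec_index (prod_decomp ?B (cone_decomp L)) = dec_index (cone_decomp L)"
        "dec_stratum (prod_decomp ?B (cone_decomp L)) = (\<lambda>k. prod_mfd ?B (cone_stratum L k))"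
        by (simp_all add: prod_decomp_def cone_decomp_def)
      \<comment> \<open>Of \<open>k\<close> it is known only that it indexes some stratum of the
        cone; \<open>cone_stratum_smooth\<close> covers the apex and the strata over the link
        alike.\<close>
      obtain k where k: "k \<in> dec_index (cone_decomp L)"
        and "mfd_diffeo ?S (prod_mfd ?B (cone_stratum L k)) \<phi>"
        using bspec[OF conjunct2[OF iso[unfolded decomp_iso_def prod]] i] unfolding Si by blast
      then have \<phi>: "mfd_smooth_map ?S (prod_mfd ?B (cone_stratum L k)) \<phi>"
        unfolding mfd_diffeo_def by blast
      have SU: "openin (mfd_top (dec_stratum X i)) (stratum_set X i \<inter> U)"
        by (subst X(2)) (rule openin_subtopology_Int2[OF U(1)])
      have S: "locally_parametrized ?S"
        by (rule locally_parametrized_open_submfd[OF X(1) SU])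
      have lpB: "locally_parametrized ?B"
        by (rule locally_parametrized_open_submfd[OF X(1) B])
      note cone = cone_stratum_smooth[OF dL A _ k]
      have CL: "\<forall>j\<in>dec_index L. CL \<subseteq> smooth_funs (dec_stratum L j)"
        using IH dL by blast
      \<comment> \<open>An element of \<open>C\<close> is its own local representative, with
        \<open>V = U\<close> at every point.\<close>
      have "f \<in> sheaf_sections (dec_top X) C U"
        unfolding sheaf_sections_def using f U(1) by blast
      then obtain g where g: "g \<in> prod_smooth (mfd_top ?B) (smooth_funs ?B) (open_cone_top (dec_top L) 1) A"
        and fg: "\<forall>p\<in>U. f p = g (\<phi> p)"
        unfolding sec by blast
      have "g \<in> smooth_funs (prod_mfd ?B (cone_stratum L k))"
        using prod_smooth_subset_smooth_funs[OF lpB cone(1)[OF CL] subtopology_topspace[symmetric]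
            mfd_top_cone_stratum subset_refl cone(2)[OF CL]] g by (rule subsetD)
      then have "(\<lambda>p. g (\<phi> p)) \<in> smooth_funs ?S"
        by (rule smooth_funs_pullback[OF S locally_parametrized_prod_mfd[OF lpB cone(1)[OF CL]] \<phi>])
      \<comment> \<open>\<open>f\<close> agrees with the pulled-back function on \<open>U\<close>,
        which contains every point of this submanifold.\<close>
      then have "f \<in> smooth_funs ?S"
        by (rule smooth_funs_cong[OF S]) (use fg mfd_points_open_submfd[OF SU] in auto)
      then show "\<exists>U. openin (mfd_top (dec_stratum X i)) U \<and> x \<in> U \<and>
          f \<in> smooth_funs (open_submfd (dec_stratum X i) U)"
        using SU x U(2) by blast
    qed
  qed
qed

theorem lemma2p6:
  fixes X :: "('a, 'i) decomp" and C :: "('a \<Rightarrow> real) set"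
  assumes "stratified_space X"
    and "smooth_structure X C"
  shows "(\<forall>i\<in>dec_index X. C \<subseteq> smooth_funs (dec_stratum X i)) \<and>
         (\<forall>f\<in>C. (\<forall>x\<in>topspace (dec_top X). f x \<noteq> 0) \<longrightarrow> (\<lambda>x. 1 / f x) \<in> C)"
proof (intro conjI ballI impI)
  fix i assume "i \<in> dec_index X"
  moreover have "decomposed_space X"
    using assms(1) by (cases rule: stratified_space.cases)
  ultimately show "C \<subseteq> smooth_funs (dec_stratum X i)"
    using smooth_structure_restrict_stratum[OF assms(2)] by blast
next
  fix f assume "f \<in> C" "\<forall>x\<in>topspace (dec_top X). f x \<noteq> 0"
  with assms(2) show "(\<lambda>x. 1 / f x) \<in> C"
    by (cases rule: smooth_structure.cases) (auto intro: Cinf_ring_reciprocal)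
qed

end
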